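(* Let $\Lambda$ be a finite dimensional algebra, let $n$ be the number of isomorphism classes of simple $\Lambda$-modules, and let $0\neq v\in\mathbb R^n$. Then the $v^\perp$ wall-and-chamber structure of $\Lambda$ is equal to the infinitesimal wall-and-chamber structure of $\Lambda$ at $v$; that is, $$\{D_{v^\perp}(X)\mid 0\ne X\in \mathrm{mod}\,\Lambda,\ v\in D(X)\}=\{D_{0,v}(X)\mid 0\ne X\in \mathrm{mod}\,\Lambda,\ v\in D(X)\}$$ as sets of cones in $v^\perp$ (and hence the chambers agree). In particular, if $\Lambda$ is a tame hereditary or tame cluster-tilted algebra with null root $\eta$, then the regular semi-invariant picture of $\Lambda$ is equal to the infinitesimal semi-invariant picture of $\Lambda$ at $g(\eta)$.
   Context: $K$ is an algebraically closed field; all algebras are finite dimensional, basic and connected over $K$; $\mathrm{mod}\,\Lambda$ is the category of finitely generated left $\Lambda$-modules. $P(1),\dots,P(n)$ are the indecomposable projectives, and $\underline{\dim}\,M\in\mathbb N^n$ has entries $\dim_K\mathrm{Hom}_\Lambda(P(i),M)$. The symbol $\cdot$ is the standard dot product on $\mathbb R^n$ and $v^\perp=\{w\in\mathbb R^n: v\cdot w=0\}$. For a nonzero module $Y$, $D(Y)=\{v\in\mathbb R^n\mid v\cdot\underline{\dim}\,Y=0,\ v\cdot\underline{\dim}\,Y'\le 0\text{ for all submodules }Y'\subseteq Y\}$. For $0\ne v\in\mathbb R^n$ and a nonzero module $X$ with $v\in D(X)$: $$D_{0,v}(X)=\{w\in v^\perp\mid \exists\,\varepsilon>0:\ v+\varepsilon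 w\in D(X)\},$$ $$D_{v^\perp}(X)=\{w\in v^\perp\mid w\cdot\underline{\dim}\,X=0,\text{ and for all submodules }X'\subseteq X:\ v\cdot\underline{\dim}\,X'=0\Rightarrow w\cdot\underline{\dim}\,X'\le 0\}.$$ The infinitesimal (resp. $v^\perp$) wall-and-chamber structure at $v$ consists of the set of all cones $D_{0,v}(X)$ (resp. $D_{v^\perp}(X)$), $0\ne X$, $v\in D(X)$, together with its chambers, which are the connected components of the complement in $v^\perp$ of the closure of the union of all these cones. The associated pictures are the sets of intersections of these cones with the unit sphere $S^{n-2}\subseteq v^\perp$. The $g$-vector of a module $M$ with minimal projective presentation $\bigoplus_i P(i)^{b_i}\to\bigoplus_i P(i)^{a_i}\to M\to 0$ is $g(M)=(a_i-b_i)_i$. Tame hereditary algebras are path algebras of Euclidean (extended Dynkin) quivers; tame cluster-tilted algebras are the algebras $\mathrm{End}_{\mathcal C(H)}(T)^{op}$ with $T$ a (basic) cluster-tilting object of the cluster category $\mathcal C(H)$ of a tame hereditary algebra $H$. In either case there is a one-parameter family of homogeneous tubes (tubes of rank 1 in the Auslander-Reiten quiver), and the modules at the mouths of the tubes in this family share a common dimension vector $\eta$, the null root, and a common $g$-vector, denoted $g(\eta)$. A module $X$ is called regular if $g(\eta)\in D(X)$. For a nonzero regular module $X$, the regular semi-invariant domain is $\{w\in g(\eta)^\perp\mid w\cdot\underline{\dim}\,X=0,\ w\cdot\underline{\dim}\,X'\le 0 \text{ for all regular submodules } X'\subseteq X\}$, and the regular semi-invariant picture is the set of intersections of the regular semi-invariant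 domains with the unit sphere $S^{n-2}\subseteq g(\eta)^\perp$. *)

theory Defs
  imports
    "HOL-Analysis.Analysis"
    "HOL-Algebra.Algebraic_Closure"
    "Jordan_Normal_Form.Missing_VectorSpace"
    "Graph_Theory.Arc_Walk"
begin

(* frees the identifier X *)
no_notation var (\<open>X\<index>\<close>)

section \<open>Finite dimensional algebras and their modules\<close>

text \<open>
  An algebra over \<open>K\<close> is a record of type \<open>('k, 'a) module\<close>: its ring part is the underlying ring,
  its scalar multiplication is the action of \<open>K\<close>. A left module over it is a record of type
  \<open>('a, 'm) module\<close>; the ring part other than the additive group is junk. The locale
  \<open>Module.module\<close> is not available for this, since it demands a commutative ring.
\<close>

definition fd_algebra :: "('k, 'z) ring_scheme \<Rightarrow> ('k, 'a) module \<Rightarrow> bool" where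
  "fd_algebra K A \<longleftrightarrow> vectorspace K A \<and> vectorspace.fin_dim K A \<and> ring A \<and>
     (\<forall>c \<in> carrier K. \<forall>x \<in> carrier A. \<forall>y \<in> carrier A.
        (c \<odot>\<^bsub>A\<^esub> x) \<otimes>\<^bsub>A\<^esub> y = c \<odot>\<^bsub>A\<^esub> (x \<otimes>\<^bsub>A\<^esub> y) \<and>
        x \<otimes>\<^bsub>A\<^esub> (c \<odot>\<^bsub>A\<^esub> y) = c \<odot>\<^bsub>A\<^esub> (x \<otimes>\<^bsub>A\<^esub> y))"

definition algebra_iso :: "('k, 'z) ring_scheme \<Rightarrow> ('k, 'a) module \<Rightarrow> ('k, 'b) module \<Rightarrow> bool" where
  "algebra_iso K A B \<longleftrightarrow> (\<exists>\<phi> \<in> ring_hom A B. bij_betw \<phi> (carrier A) (carrier B) \<and>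
     (\<forall>c \<in> carrier K. \<forall>x \<in> carrier A. \<phi> (c \<odot>\<^bsub>A\<^esub> x) = c \<odot>\<^bsub>B\<^esub> \<phi> x))"

locale left_module = A?: ring A + M?: abelian_group M
  for A :: "('a, 'z) ring_scheme" and M :: "('a, 'm) module" +
  assumes smult_closed: "\<lbrakk>a \<in> carrier A; x \<in> carrier M\<rbrakk> \<Longrightarrow> a \<odot>\<^bsub>M\<^esub> x \<in> carrier M"
    and smult_l_distr: "\<lbrakk>a \<in> carrier A; b \<in> carrier A; x \<in> carrier M\<rbrakk> \<Longrightarrow>
      (a \<oplus>\<^bsub>A\<^esub> b) \<odot>\<^bsub>M\<^esub> x = a \<odot>\<^bsub>M\<^esub> x \<oplus>\<^bsub>M\<^esub> b \<odot>\<^bsub>M\<^esub> x"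
    and smult_r_distr: "\<lbrakk>a \<in> carrier A; x \<in> carrier M; y \<in> carrier M\<rbrakk> \<Longrightarrow>
      a \<odot>\<^bsub>M\<^esub> (x \<oplus>\<^bsub>M\<^esub> y) = a \<odot>\<^bsub>M\<^esub> x \<oplus>\<^bsub>M\<^esub> a \<odot>\<^bsub>M\<^esub> y"
    and smult_assoc: "\<lbrakk>a \<in> carrier A; b \<in> carrier A; x \<in> carrier M\<rbrakk> \<Longrightarrow>
      (a \<otimes>\<^bsub>A\<^esub> b) \<odot>\<^bsub>M\<^esub> x = a \<odot>\<^bsub>M\<^esub> (b \<odot>\<^bsub>M\<^esub> x)"
    and smult_one: "x \<in> carrier M \<Longrightarrow> \<one>\<^bsub>A\<^esub> \<odot>\<^bsub>M\<^esub> x = x"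

definition submod :: "('a, 'z) ring_scheme \<Rightarrow> ('a, 'm) module \<Rightarrow> 'm set \<Rightarrow> bool" where
  "submod A M N \<longleftrightarrow> Module.submodule N A M"

abbreviation sub :: "('a, 'm) module \<Rightarrow> 'm set \<Rightarrow> ('a, 'm) module" where
  "sub M N \<equiv> M\<lparr>carrier := N\<rparr>"

definition fg_mod :: "('a, 'z) ring_scheme \<Rightarrow> ('a, 'm) module set" where
  "fg_mod A = {M. left_module A M \<and>
     (\<exists>S. finite S \<and> S \<subseteq> carrier M \<and> (\<forall>N. submod A M N \<and> S \<subseteq> N \<longrightarrow> N = carrier M))}"

definition nonzero :: "('a, 'm) module \<Rightarrow> bool" where
  "nonzero M \<longleftrightarrow> carrier M \<noteq> {\<zero>\<^bsub>M\<^esub>}"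

definition lhom :: "('a, 'z) ring_scheme \<Rightarrow> ('a, 'm) module \<Rightarrow> ('a, 'n) module \<Rightarrow> ('m \<Rightarrow> 'n) set" where
  "lhom A M N = module_hom A M N \<inter> extensional (carrier M)"

definition mod_iso :: "('a, 'z) ring_scheme \<Rightarrow> ('a, 'm) module \<Rightarrow> ('a, 'n) module \<Rightarrow> bool" where
  "mod_iso A M N \<longleftrightarrow> (\<exists>f \<in> lhom A M N. bij_betw f (carrier M) (carrier N))"

definition zero_map :: "('a, 'm) module \<Rightarrow> ('a, 'n) module \<Rightarrow> 'm \<Rightarrow> 'n" where
  "zero_map M N = (\<lambda>x \<in> carrier M. \<zero>\<^bsub>N\<^esub>)"

definition add_map :: "('a, 'm) module \<Rightarrow> ('a, 'n) module \<Rightarrow> ('m \<Rightarrow> 'n) \<Rightarrow> ('m \<Rightarrow> 'n) \<Rightarrow> 'm \<Rightarrow> 'n" where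
  "add_map M N f g = (\<lambda>x \<in> carrier M. f x \<oplus>\<^bsub>N\<^esub> g x)"

text \<open>\<open>K\<close> acts on a module through \<open>K \<rightarrow> A\<close>, \<open>c \<mapsto> c 1\<close>.\<close>

definition scale_map ::
    "('k, 'a) module \<Rightarrow> ('a, 'm) module \<Rightarrow> ('a, 'n) module \<Rightarrow> 'k \<Rightarrow> ('m \<Rightarrow> 'n) \<Rightarrow> 'm \<Rightarrow> 'n" where
  "scale_map A M N c f = (\<lambda>x \<in> carrier M. (c \<odot>\<^bsub>A\<^esub> \<one>\<^bsub>A\<^esub>) \<odot>\<^bsub>N\<^esub> f x)"

definition hom_space ::
    "('k, 'a) module \<Rightarrow> ('a, 'm) module \<Rightarrow> ('a, 'n) module \<Rightarrow> ('k, 'm \<Rightarrow> 'n) module" where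
  "hom_space A M N = \<lparr>carrier = lhom A M N, mult = (\<lambda>f g. zero_map M N), one = zero_map M N,
     zero = zero_map M N, add = add_map M N, smult = scale_map A M N\<rparr>"

definition simple_mod :: "('a, 'z) ring_scheme \<Rightarrow> ('a, 'm) module \<Rightarrow> bool" where
  "simple_mod A S \<longleftrightarrow> S \<in> fg_mod A \<and> nonzero S \<and>
     (\<forall>N. submod A S N \<longrightarrow> N = {\<zero>\<^bsub>S\<^esub>} \<or> N = carrier S)"

definition indecomposable :: "('a, 'z) ring_scheme \<Rightarrow> ('a, 'm) module \<Rightarrow> bool" where
  "indecomposable A M \<longleftrightarrow> nonzero M \<and>
     (\<forall>U V. submod A M U \<and> submod A M V \<and> U \<inter> V = {\<zero>\<^bsub>M\<^esub>} \<and> U <+>\<^bsub>M\<^esub> V = carrier M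
        \<longrightarrow> U = {\<zero>\<^bsub>M\<^esub>} \<or> V = {\<zero>\<^bsub>M\<^esub>})"

definition projective :: "('a, 'z) ring_scheme \<Rightarrow> ('a, 'm) module \<Rightarrow> bool" where
  "projective A Q \<longleftrightarrow> (\<forall>(M :: ('a, 'm) module) (N :: ('a, 'm) module) g f.
     M \<in> fg_mod A \<and> N \<in> fg_mod A \<and> g \<in> lhom A M N \<and> g ` carrier M = carrier N \<and>
     f \<in> lhom A Q N \<longrightarrow> (\<exists>h \<in> lhom A Q M. \<forall>x \<in> carrier Q. g (h x) = f x))"

text \<open>
  From here on the finitely generated modules over an algebra over \<open>K\<close> (with \<open>carrier K\<close> a subset of
  the type \<open>'k\<close>) are taken with carriers in the type \<open>nat \<Rightarrow> 'k\<close>. As such a module has a carrier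
  equipotent to some \<open>K ^ d\<close>, every isomorphism class is represented.
\<close>

type_synonym ('k, 'a) lmod = "('a, nat \<Rightarrow> 'k) module"

definition num_simples :: "('k, 'a) module \<Rightarrow> nat" where
  "num_simples A = card {C. \<exists>S :: ('k, 'a) lmod. simple_mod A S \<and>
     C = {S' :: ('k, 'a) lmod. simple_mod A S' \<and> mod_iso A S' S}}"

definition indec_projectives :: "('k, 'a) module \<Rightarrow> ('n \<Rightarrow> ('k, 'a) lmod) \<Rightarrow> bool" where
  "indec_projectives A P \<longleftrightarrow>
     (\<forall>i. P i \<in> fg_mod A \<and> projective A (P i) \<and> indecomposable A (P i)) \<and>
     (\<forall>i j. mod_iso A (P i) (P j) \<longrightarrow> i = j) \<and>
     (\<forall>Q :: ('k, 'a) lmod. Q \<in> fg_mod A \<and> projective A Q \<and> indecomposable A Q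
        \<longrightarrow> (\<exists>i. mod_iso A Q (P i)))"

text \<open>\<open>A\<close> is basic if \<open>A e\<close> and \<open>A f\<close> are not isomorphic for distinct members \<open>e\<close>, \<open>f\<close> of a complete
  set of primitive orthogonal idempotents.\<close>

definition idempotent :: "('k, 'a) module \<Rightarrow> 'a \<Rightarrow> bool" where
  "idempotent A e \<longleftrightarrow> e \<in> carrier A \<and> e \<otimes>\<^bsub>A\<^esub> e = e"

definition orthogonal_idems :: "('k, 'a) module \<Rightarrow> 'a \<Rightarrow> 'a \<Rightarrow> bool" where
  "orthogonal_idems A e f \<longleftrightarrow> idempotent A e \<and> idempotent A f \<and>
     e \<otimes>\<^bsub>A\<^esub> f = \<zero>\<^bsub>A\<^esub> \<and> f \<otimes>\<^bsub>A\<^esub> e = \<zero>\<^bsub>A\<^esub>"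

definition primitive_idem :: "('k, 'a) module \<Rightarrow> 'a \<Rightarrow> bool" where
  "primitive_idem A e \<longleftrightarrow> idempotent A e \<and> e \<noteq> \<zero>\<^bsub>A\<^esub> \<and>
     (\<forall>f g. orthogonal_idems A f g \<and> e = f \<oplus>\<^bsub>A\<^esub> g \<longrightarrow> f = \<zero>\<^bsub>A\<^esub> \<or> g = \<zero>\<^bsub>A\<^esub>)"

definition left_ideal_of :: "('k, 'a) module \<Rightarrow> 'a \<Rightarrow> ('a, 'a) module" where
  "left_ideal_of A e = \<lparr>carrier = (\<lambda>a. a \<otimes>\<^bsub>A\<^esub> e) ` carrier A, mult = mult A, one = one A,
     zero = zero A, add = add A, smult = mult A\<rparr>"

definition basic_algebra :: "('k, 'a) module \<Rightarrow> bool" where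
  "basic_algebra A \<longleftrightarrow> (\<exists>E. finite E \<and> (\<forall>e \<in> E. primitive_idem A e) \<and>
     (\<forall>e \<in> E. \<forall>f \<in> E. e \<noteq> f \<longrightarrow>
        orthogonal_idems A e f \<and> \<not> mod_iso A (left_ideal_of A e) (left_ideal_of A f)) \<and>
     (\<Oplus>\<^bsub>A\<^esub>e \<in> E. e) = \<one>\<^bsub>A\<^esub>)"

definition connected_algebra :: "('k, 'a) module \<Rightarrow> bool" where
  "connected_algebra A \<longleftrightarrow> \<one>\<^bsub>A\<^esub> \<noteq> \<zero>\<^bsub>A\<^esub> \<and>
     (\<forall>e. idempotent A e \<and> (\<forall>a \<in> carrier A. a \<otimes>\<^bsub>A\<^esub> e = e \<otimes>\<^bsub>A\<^esub> a) \<longrightarrow> e = \<zero>\<^bsub>A\<^esub> \<or> e = \<one>\<^bsub>A\<^esub>)"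


section \<open>Wall-and-chamber structures\<close>

text \<open>The arguments \<open>K\<close>, \<open>A\<close> and \<open>P\<close> below are the field, the algebra and the family of its
  indecomposable projectives, indexed by the coordinates of \<open>real ^ 'n\<close>.\<close>

definition dimvec ::
    "'k ring \<Rightarrow> ('k, 'a) module \<Rightarrow> ('n \<Rightarrow> ('k, 'a) lmod) \<Rightarrow> ('k, 'a) lmod \<Rightarrow> real ^ 'n" where
  "dimvec K A P M = (\<chi> i. real (vectorspace.dim K (hom_space A (P i) M)))"

definition semistability_domain ::
    "'k ring \<Rightarrow> ('k, 'a) module \<Rightarrow> ('n::finite \<Rightarrow> ('k, 'a) lmod) \<Rightarrow> ('k, 'a) lmod \<Rightarrow> (real ^ 'n) set" where
  "semistability_domain K A P Y = {v. v \<bullet> dimvec K A P Y = 0 \<and>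
     (\<forall>Y'. submod A Y Y' \<longrightarrow> v \<bullet> dimvec K A P (sub Y Y') \<le> 0)}"

definition perp :: "real ^ 'n \<Rightarrow> (real ^ 'n) set" where
  "perp v = {w. v \<bullet> w = 0}"

definition D_inf ::
    "'k ring \<Rightarrow> ('k, 'a) module \<Rightarrow> ('n::finite \<Rightarrow> ('k, 'a) lmod) \<Rightarrow> real ^ 'n \<Rightarrow> ('k, 'a) lmod
      \<Rightarrow> (real ^ 'n) set" where
  "D_inf K A P v X = {w \<in> perp v. \<exists>\<epsilon> > 0. v + \<epsilon> *\<^sub>R w \<in> semistability_domain K A P X}"

definition D_perp ::
    "'k ring \<Rightarrow> ('k, 'a) module \<Rightarrow> ('n::finite \<Rightarrow> ('k, 'a) lmod) \<Rightarrow> real ^ 'n \<Rightarrow> ('k, 'a) lmod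
      \<Rightarrow> (real ^ 'n) set" where
  "D_perp K A P v X = {w \<in> perp v. w \<bullet> dimvec K A P X = 0 \<and>
     (\<forall>X'. submod A X X' \<and> v \<bullet> dimvec K A P (sub X X') = 0
        \<longrightarrow> w \<bullet> dimvec K A P (sub X X') \<le> 0)}"

definition infinitesimal_walls ::
    "'k ring \<Rightarrow> ('k, 'a) module \<Rightarrow> ('n::finite \<Rightarrow> ('k, 'a) lmod) \<Rightarrow> real ^ 'n \<Rightarrow> (real ^ 'n) set set" where
  "infinitesimal_walls K A P v =
     {D_inf K A P v X | X. X \<in> fg_mod A \<and> nonzero X \<and> v \<in> semistability_domain K A P X}"

definition perp_walls ::
    "'k ring \<Rightarrow> ('k, 'a) module \<Rightarrow> ('n::finite \<Rightarrow> ('k, 'a) lmod) \<Rightarrow> real ^ 'n \<Rightarrow> (real ^ 'n) set set" where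
  "perp_walls K A P v =
     {D_perp K A P v X | X. X \<in> fg_mod A \<and> nonzero X \<and> v \<in> semistability_domain K A P X}"

definition chambers :: "real ^ 'n \<Rightarrow> (real ^ 'n::finite) set set \<Rightarrow> (real ^ 'n) set set" where
  "chambers v \<W> = components (perp v - closure (\<Union>\<W>))"

definition infinitesimal_structure ::
    "'k ring \<Rightarrow> ('k, 'a) module \<Rightarrow> ('n::finite \<Rightarrow> ('k, 'a) lmod) \<Rightarrow> real ^ 'n
      \<Rightarrow> (real ^ 'n) set set \<times> (real ^ 'n) set set" where
  "infinitesimal_structure K A P v =
     (infinitesimal_walls K A P v, chambers v (infinitesimal_walls K A P v))"

definition perp_structure ::
    "'k ring \<Rightarrow> ('k, 'a) module \<Rightarrow> ('n::finite \<Rightarrow> ('k, 'a) lmod) \<Rightarrow> real ^ 'n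
      \<Rightarrow> (real ^ 'n) set set \<times> (real ^ 'n) set set" where
  "perp_structure K A P v = (perp_walls K A P v, chambers v (perp_walls K A P v))"

definition picture :: "real ^ 'n \<Rightarrow> (real ^ 'n::finite) set set \<Rightarrow> (real ^ 'n) set set" where
  "picture v \<W> = {C \<inter> (perp v \<inter> sphere 0 1) | C. C \<in> \<W>}"

definition infinitesimal_picture ::
    "'k ring \<Rightarrow> ('k, 'a) module \<Rightarrow> ('n::finite \<Rightarrow> ('k, 'a) lmod) \<Rightarrow> real ^ 'n \<Rightarrow> (real ^ 'n) set set" where
  "infinitesimal_picture K A P v = picture v (infinitesimal_walls K A P v)"

text \<open>In the next three definitions \<open>g\<close> stands for \<open>g(\<eta>)\<close>.\<close>

definition regular ::
    "'k ring \<Rightarrow> ('k, 'a) module \<Rightarrow> ('n::finite \<Rightarrow> ('k, 'a) lmod) \<Rightarrow> real ^ 'n \<Rightarrow> ('k, 'a) lmod \<Rightarrow> bool" where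
  "regular K A P g X \<longleftrightarrow> nonzero X \<and> g \<in> semistability_domain K A P X"

definition regular_domain ::
    "'k ring \<Rightarrow> ('k, 'a) module \<Rightarrow> ('n::finite \<Rightarrow> ('k, 'a) lmod) \<Rightarrow> real ^ 'n \<Rightarrow> ('k, 'a) lmod
      \<Rightarrow> (real ^ 'n) set" where
  "regular_domain K A P g X = {w \<in> perp g. w \<bullet> dimvec K A P X = 0 \<and>
     (\<forall>X'. submod A X X' \<and> regular K A P g (sub X X') \<longrightarrow> w \<bullet> dimvec K A P (sub X X') \<le> 0)}"

definition regular_picture ::
    "'k ring \<Rightarrow> ('k, 'a) module \<Rightarrow> ('n::finite \<Rightarrow> ('k, 'a) lmod) \<Rightarrow> real ^ 'n \<Rightarrow> (real ^ 'n) set set" where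
  "regular_picture K A P g =
     picture g {regular_domain K A P g X | X. X \<in> fg_mod A \<and> regular K A P g X}"


section \<open>$g$-vectors\<close>

text \<open>\<open>Q\<close> is isomorphic to the direct sum of \<open>a i\<close> copies of \<open>P i\<close>, over all \<open>i\<close>.\<close>

definition is_direct_sum ::
    "('a, 'z) ring_scheme \<Rightarrow> ('n::finite \<Rightarrow> ('a, 'm) module) \<Rightarrow> ('n \<Rightarrow> nat) \<Rightarrow> ('a, 'm) module \<Rightarrow> bool" where
  "is_direct_sum A P a Q \<longleftrightarrow> (\<exists>\<iota> \<pi>. let I = {(i, k). k < a i} in
     (\<forall>j \<in> I. \<iota> j \<in> lhom A (P (fst j)) Q \<and> \<pi> j \<in> lhom A Q (P (fst j)) \<and>
        (\<forall>x \<in> carrier (P (fst j)). \<pi> j (\<iota> j x) = x \<and>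
           (\<forall>j' \<in> I. j' \<noteq> j \<longrightarrow> \<pi> j' (\<iota> j x) = \<zero>\<^bsub>P (fst j')\<^esub>))) \<and>
     (\<forall>x \<in> carrier Q. (\<Oplus>\<^bsub>Q\<^esub>j \<in> I. \<iota> j (\<pi> j x)) = x))"

definition projective_cover ::
    "('a, 'z) ring_scheme \<Rightarrow> ('a, 'm) module \<Rightarrow> ('a, 'm) module \<Rightarrow> ('m \<Rightarrow> 'm) \<Rightarrow> bool" where
  "projective_cover A Q M p \<longleftrightarrow> Q \<in> fg_mod A \<and> projective A Q \<and>
     p \<in> lhom A Q M \<and> p ` carrier Q = carrier M \<and>
     (\<forall>L. submod A Q L \<and> p ` L = carrier M \<longrightarrow> L = carrier Q)"

definition minimal_presentation ::
    "('a, 'z) ring_scheme \<Rightarrow> ('n::finite \<Rightarrow> ('a, 'm) module) \<Rightarrow> ('a, 'm) module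
      \<Rightarrow> ('n \<Rightarrow> nat) \<Rightarrow> ('n \<Rightarrow> nat) \<Rightarrow> bool" where
  "minimal_presentation A P M a b \<longleftrightarrow> (\<exists>Q0 Q1 p q.
     is_direct_sum A P a Q0 \<and> is_direct_sum A P b Q1 \<and> projective_cover A Q0 M p \<and>
     projective_cover A Q1 (sub Q0 {x \<in> carrier Q0. p x = \<zero>\<^bsub>M\<^esub>}) q)"

definition is_gvector ::
    "('a, 'z) ring_scheme \<Rightarrow> ('n::finite \<Rightarrow> ('a, 'm) module) \<Rightarrow> ('a, 'm) module \<Rightarrow> real ^ 'n \<Rightarrow> bool" where
  "is_gvector A P M g \<longleftrightarrow> (\<exists>a b. minimal_presentation A P M a b \<and> g = (\<chi> i. real (a i) - real (b i)))"


section \<open>The Auslander-Reiten quiver and homogeneous tubes\<close>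

definition split_mono ::
    "('a, 'z) ring_scheme \<Rightarrow> ('a, 'm) module \<Rightarrow> ('a, 'm) module \<Rightarrow> ('m \<Rightarrow> 'm) \<Rightarrow> bool" where
  "split_mono A M N f \<longleftrightarrow> (\<exists>r \<in> lhom A N M. \<forall>x \<in> carrier M. r (f x) = x)"

definition split_epi ::
    "('a, 'z) ring_scheme \<Rightarrow> ('a, 'm) module \<Rightarrow> ('a, 'm) module \<Rightarrow> ('m \<Rightarrow> 'm) \<Rightarrow> bool" where
  "split_epi A M N g \<longleftrightarrow> (\<exists>s \<in> lhom A N M. \<forall>y \<in> carrier N. g (s y) = y)"

definition left_almost_split ::
    "('a, 'z) ring_scheme \<Rightarrow> ('a, 'm) module \<Rightarrow> ('a, 'm) module \<Rightarrow> ('m \<Rightarrow> 'm) \<Rightarrow> bool" where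
  "left_almost_split A L E f \<longleftrightarrow> f \<in> lhom A L E \<and> \<not> split_mono A L E f \<and>
     (\<forall>Z \<in> fg_mod A. \<forall>u \<in> lhom A L Z. \<not> split_mono A L Z u
        \<longrightarrow> (\<exists>h \<in> lhom A E Z. \<forall>x \<in> carrier L. u x = h (f x)))"

definition right_almost_split ::
    "('a, 'z) ring_scheme \<Rightarrow> ('a, 'm) module \<Rightarrow> ('a, 'm) module \<Rightarrow> ('m \<Rightarrow> 'm) \<Rightarrow> bool" where
  "right_almost_split A E N g \<longleftrightarrow> g \<in> lhom A E N \<and> \<not> split_epi A E N g \<and>
     (\<forall>Z \<in> fg_mod A. \<forall>u \<in> lhom A Z N. \<not> split_epi A Z N u
        \<longrightarrow> (\<exists>h \<in> lhom A Z E. \<forall>x \<in> carrier Z. u x = g (h x)))"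

text \<open>\<open>L\<close> is isomorphic to the Auslander-Reiten translate of \<open>N\<close>: there is an almost split sequence
  \<open>0 \<rightarrow> L \<rightarrow> E \<rightarrow> N \<rightarrow> 0\<close>.\<close>

definition is_AR_translate :: "('a, 'z) ring_scheme \<Rightarrow> ('a, 'm) module \<Rightarrow> ('a, 'm) module \<Rightarrow> bool" where
  "is_AR_translate A L N \<longleftrightarrow> (\<exists>E \<in> fg_mod A. \<exists>f g.
     left_almost_split A L E f \<and> right_almost_split A E N g \<and>
     inj_on f (carrier L) \<and> f ` carrier L = {x \<in> carrier E. g x = \<zero>\<^bsub>N\<^esub>} \<and>
     g ` carrier E = carrier N)"

definition rad :: "('a, 'z) ring_scheme \<Rightarrow> ('a, 'm) module \<Rightarrow> ('a, 'm) module \<Rightarrow> ('m \<Rightarrow> 'm) set" where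
  "rad A M N = {f \<in> lhom A M N. \<forall>h \<in> lhom A N M.
     bij_betw (\<lambda>x. x \<ominus>\<^bsub>M\<^esub> h (f x)) (carrier M) (carrier M)}"

definition rad2 :: "('a, 'z) ring_scheme \<Rightarrow> ('a, 'm) module \<Rightarrow> ('a, 'm) module \<Rightarrow> ('m \<Rightarrow> 'm) set" where
  "rad2 A M N = {compose (carrier M) g f | Z f g. Z \<in> fg_mod A \<and> f \<in> rad A M Z \<and> g \<in> rad A Z N}"

text \<open>The number of arrows from \<open>M\<close> to \<open>N\<close> in the Auslander-Reiten quiver, i.e. the dimension of the
  space \<open>rad A M N / rad2 A M N\<close> of irreducible morphisms.\<close>

definition AR_arrows :: "'k ring \<Rightarrow> ('k, 'a) module \<Rightarrow> ('k, 'a) lmod \<Rightarrow> ('k, 'a) lmod \<Rightarrow> nat" where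
  "AR_arrows K A M N = vectorspace.dim K ((hom_space A M N)\<lparr>carrier := rad A M N\<rparr>)
     - vectorspace.dim K ((hom_space A M N)\<lparr>carrier := rad2 A M N\<rparr>)"

text \<open>The modules \<open>T 0, T 1, T 2, \<dots>\<close> represent the vertices of a component of the Auslander-Reiten
  quiver that is a tube of rank 1 (of shape \<open>\<int>A\<^sub>\<infinity>/\<langle>\<tau>\<rangle>\<close>):
  \<open>T 0 \<leftrightarrow> T 1 \<leftrightarrow> T 2 \<leftrightarrow> \<dots>\<close> with \<open>\<tau> (T i) = T i\<close>. Its mouth is \<open>T 0\<close>.\<close>

definition homogeneous_tube :: "'k ring \<Rightarrow> ('k, 'a) module \<Rightarrow> (nat \<Rightarrow> ('k, 'a) lmod) \<Rightarrow> bool" where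
  "homogeneous_tube K A T \<longleftrightarrow>
     (\<forall>i. T i \<in> fg_mod A \<and> indecomposable A (T i) \<and> is_AR_translate A (T i) (T i)) \<and>
     (\<forall>i j. mod_iso A (T i) (T j) \<longrightarrow> i = j) \<and>
     (\<forall>i. \<forall>N \<in> fg_mod A. indecomposable A N \<longrightarrow>
        (let m = (if mod_iso A N (T (Suc i)) \<or> (\<exists>j. i = Suc j \<and> mod_iso A N (T j)) then 1 else 0)
         in AR_arrows K A (T i) N = m \<and> AR_arrows K A N (T i) = m))"

text \<open>\<open>\<eta>\<close> and \<open>g\<close> are the dimension vector and the \<open>g\<close>-vector of a module at the mouth of a homogeneous
  tube.\<close>

definition null_root ::
    "'k ring \<Rightarrow> ('k, 'a) module \<Rightarrow> ('n::finite \<Rightarrow> ('k, 'a) lmod) \<Rightarrow> real ^ 'n \<Rightarrow> real ^ 'n \<Rightarrow> bool" where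
  "null_root K A P \<eta> g \<longleftrightarrow>
     (\<exists>T. homogeneous_tube K A T \<and> \<eta> = dimvec K A P (T 0) \<and> is_gvector A P (T 0) g)"


section \<open>Tame hereditary algebras\<close>

text \<open>Vertex count and edge list of the Euclidean diagrams. The one-vertex diagram (a
  loop) is omitted: its quiver has an oriented cycle.\<close>

inductive euclidean_diagram :: "nat \<Rightarrow> (nat \<times> nat) list \<Rightarrow> bool" where
  A: "n \<ge> 1 \<Longrightarrow> euclidean_diagram (n + 1) (map (\<lambda>i. (i, (i + 1) mod (n + 1))) [0..<n + 1])"
| D: "n \<ge> 4 \<Longrightarrow> euclidean_diagram (n + 1)
        ([(0, 2), (1, 2)] @ map (\<lambda>i. (i, i + 1)) [2..<n - 2] @ [(n - 2, n - 1), (n - 2, n)])"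
| E6: "euclidean_diagram 7 [(0, 1), (1, 2), (0, 3), (3, 4), (0, 5), (5, 6)]"
| E7: "euclidean_diagram 8 [(0, 1), (0, 2), (2, 3), (3, 4), (0, 5), (5, 6), (6, 7)]"
| E8: "euclidean_diagram 9 [(0, 1), (0, 2), (2, 3), (0, 4), (4, 5), (5, 6), (6, 7), (7, 8)]"

text \<open>Quivers are finite directed multigraphs. A quiver without oriented cycles is one whose path
  algebra is finite dimensional.\<close>

type_synonym quiver = "(nat, nat) pre_digraph"

definition euclidean_quiver :: "quiver \<Rightarrow> bool" where
  "euclidean_quiver Q \<longleftrightarrow> fin_digraph Q \<and> (\<exists>N es \<phi> \<psi>. euclidean_diagram N es \<and>
     bij_betw \<phi> (verts Q) {..<N} \<and> bij_betw \<psi> (arcs Q) {..<length es} \<and>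
     (\<forall>a \<in> arcs Q. {\<phi> (tail Q a), \<phi> (head Q a)} = {fst (es ! \<psi> a), snd (es ! \<psi> a)}))"

definition acyclic_quiver :: "quiver \<Rightarrow> bool" where
  "acyclic_quiver Q \<longleftrightarrow> (\<nexists>u p. p \<noteq> [] \<and> pre_digraph.awalk Q u p u)"

text \<open>A path is given by its start, its list of arrows and its end.\<close>

type_synonym qpath = "nat \<times> nat list \<times> nat"

definition paths :: "quiver \<Rightarrow> qpath set" where
  "paths Q = {(u, p, v). pre_digraph.awalk Q u p v}"

text \<open>The product of two paths is their concatenation, left factor first. The opposite convention
  gives the path algebra of the opposite quiver, which is Euclidean if and only if \<open>Q\<close> is.\<close>

definition path_algebra :: "'k ring \<Rightarrow> quiver \<Rightarrow> ('k, qpath \<Rightarrow> 'k) module" where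
  "path_algebra K Q =
     \<lparr>carrier = {f \<in> paths Q \<rightarrow>\<^sub>E carrier K. finite {r \<in> paths Q. f r \<noteq> \<zero>\<^bsub>K\<^esub>}},
      mult = (\<lambda>f g. \<lambda>(u, r, v) \<in> paths Q.
        \<Oplus>\<^bsub>K\<^esub>s \<in> {(p, w, q). (u, p, w) \<in> paths Q \<and> (w, q, v) \<in> paths Q \<and> p @ q = r}.
          case s of (p, w, q) \<Rightarrow> f (u, p, w) \<otimes>\<^bsub>K\<^esub> g (w, q, v)),
      one = (\<lambda>(u, r, v) \<in> paths Q. if r = [] then \<one>\<^bsub>K\<^esub> else \<zero>\<^bsub>K\<^esub>),
      zero = (\<lambda>r \<in> paths Q. \<zero>\<^bsub>K\<^esub>),
      add = (\<lambda>f g. \<lambda>r \<in> paths Q. f r \<oplus>\<^bsub>K\<^esub> g r),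
      smult = (\<lambda>c f. \<lambda>r \<in> paths Q. c \<otimes>\<^bsub>K\<^esub> f r)\<rparr>"

definition tame_hereditary :: "'k ring \<Rightarrow> ('k, 'a) module \<Rightarrow> bool" where
  "tame_hereditary K A \<longleftrightarrow>
     (\<exists>Q. euclidean_quiver Q \<and> acyclic_quiver Q \<and> algebra_iso K A (path_algebra K Q))"


section \<open>The bounded derived category\<close>

text \<open>\<open>K\<close>-linear categories, with \<open>Cmp C X Y Z g f\<close> the composite of \<open>f : X \<rightarrow> Y\<close> and
  \<open>g : Y \<rightarrow> Z\<close>.\<close>

record ('k, 'o, 'f) lin_cat =
  Obj :: "'o set"
  Mor :: "'o \<Rightarrow> 'o \<Rightarrow> ('k, 'f) module"
  Cmp :: "'o \<Rightarrow> 'o \<Rightarrow> 'o \<Rightarrow> 'f \<Rightarrow> 'f \<Rightarrow> 'f"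
  Idt :: "'o \<Rightarrow> 'f"

record ('a, 'm) cochain =
  term_at :: "int \<Rightarrow> ('a, 'm) module"
  diff_at :: "int \<Rightarrow> 'm \<Rightarrow> 'm"

definition bounded_complex :: "('a, 'z) ring_scheme \<Rightarrow> ('a, 'm) cochain \<Rightarrow> bool" where
  "bounded_complex A X \<longleftrightarrow>
     (\<forall>i. term_at X i \<in> fg_mod A \<and> diff_at X i \<in> lhom A (term_at X i) (term_at X (i + 1)) \<and>
        (\<forall>x \<in> carrier (term_at X i). diff_at X (i + 1) (diff_at X i x) = \<zero>\<^bsub>term_at X (i + 2)\<^esub>)) \<and>
     finite {i. nonzero (term_at X i)}"

definition chain_maps ::
    "('a, 'z) ring_scheme \<Rightarrow> ('a, 'm) cochain \<Rightarrow> ('a, 'm) cochain \<Rightarrow> (int \<Rightarrow> 'm \<Rightarrow> 'm) set" where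
  "chain_maps A X Y = {f. \<forall>i. f i \<in> lhom A (term_at X i) (term_at Y i) \<and>
     (\<forall>x \<in> carrier (term_at X i). diff_at Y i (f i x) = f (i + 1) (diff_at X i x))}"

definition ch_comp ::
    "('a, 'm) cochain \<Rightarrow> (int \<Rightarrow> 'm \<Rightarrow> 'm) \<Rightarrow> (int \<Rightarrow> 'm \<Rightarrow> 'm) \<Rightarrow> int \<Rightarrow> 'm \<Rightarrow> 'm" where
  "ch_comp X g f = (\<lambda>i. compose (carrier (term_at X i)) (g i) (f i))"

definition ch_id :: "('a, 'm) cochain \<Rightarrow> int \<Rightarrow> 'm \<Rightarrow> 'm" where
  "ch_id X = (\<lambda>i. \<lambda>x \<in> carrier (term_at X i). x)"

definition homotopic ::
    "('a, 'z) ring_scheme \<Rightarrow> ('a, 'm) cochain \<Rightarrow> ('a, 'm) cochain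
      \<Rightarrow> (int \<Rightarrow> 'm \<Rightarrow> 'm) \<Rightarrow> (int \<Rightarrow> 'm \<Rightarrow> 'm) \<Rightarrow> bool" where
  "homotopic A X Y f g \<longleftrightarrow> (\<exists>h. (\<forall>i. h i \<in> lhom A (term_at X i) (term_at Y (i - 1))) \<and>
     (\<forall>i. \<forall>x \<in> carrier (term_at X i).
        f i x = g i x \<oplus>\<^bsub>term_at Y i\<^esub>
          (diff_at Y (i - 1) (h i x) \<oplus>\<^bsub>term_at Y i\<^esub> h (i + 1) (diff_at X i x))))"

definition cycles :: "('a, 'm) cochain \<Rightarrow> int \<Rightarrow> 'm set" where
  "cycles X i = {x \<in> carrier (term_at X i). diff_at X i x = \<zero>\<^bsub>term_at X (i + 1)\<^esub>}"

definition boundaries :: "('a, 'm) cochain \<Rightarrow> int \<Rightarrow> 'm set" where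
  "boundaries X i = diff_at X (i - 1) ` carrier (term_at X (i - 1))"

text \<open>The two clauses say that the maps induced on cohomology are injective and surjective.\<close>

definition quasi_isos ::
    "('a, 'z) ring_scheme \<Rightarrow> ('a, 'm) cochain \<Rightarrow> ('a, 'm) cochain \<Rightarrow> (int \<Rightarrow> 'm \<Rightarrow> 'm) set" where
  "quasi_isos A X Y = {s \<in> chain_maps A X Y. \<forall>i.
     (\<forall>x \<in> cycles X i. s i x \<in> boundaries Y i \<longrightarrow> x \<in> boundaries X i) \<and>
     (\<forall>y \<in> cycles Y i. \<exists>x \<in> cycles X i. \<exists>b \<in> boundaries Y i. y = s i x \<oplus>\<^bsub>term_at Y i\<^esub> b)}"

text \<open>A morphism \<open>X \<rightarrow> Y\<close> of the bounded derived category is an equivalence class of roofs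
  \<open>X \<leftarrow> Z \<rightarrow> Y\<close> whose left leg is a quasi-isomorphism; the calculus of fractions takes place in the
  homotopy category.\<close>

type_synonym ('a, 'm) roof = "('a, 'm) cochain \<times> (int \<Rightarrow> 'm \<Rightarrow> 'm) \<times> (int \<Rightarrow> 'm \<Rightarrow> 'm)"

definition roofs ::
    "('a, 'z) ring_scheme \<Rightarrow> ('a, 'm) cochain \<Rightarrow> ('a, 'm) cochain \<Rightarrow> ('a, 'm) roof set" where
  "roofs A X Y = {(Z, s, f). bounded_complex A Z \<and> s \<in> quasi_isos A Z X \<and> f \<in> chain_maps A Z Y}"

definition roof_equiv ::
    "('a, 'z) ring_scheme \<Rightarrow> ('a, 'm) cochain \<Rightarrow> ('a, 'm) cochain
      \<Rightarrow> ('a, 'm) roof \<Rightarrow> ('a, 'm) roof \<Rightarrow> bool" where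
  "roof_equiv A X Y = (\<lambda>(Z, s, f) (Z', s', f'). \<exists>W u u'. bounded_complex A W \<and>
     u \<in> chain_maps A W Z \<and> u' \<in> chain_maps A W Z' \<and> ch_comp W s u \<in> quasi_isos A W X \<and>
     homotopic A W X (ch_comp W s u) (ch_comp W s' u') \<and>
     homotopic A W Y (ch_comp W f u) (ch_comp W f' u'))"

definition roof_class ::
    "('a, 'z) ring_scheme \<Rightarrow> ('a, 'm) cochain \<Rightarrow> ('a, 'm) cochain \<Rightarrow> ('a, 'm) roof \<Rightarrow> ('a, 'm) roof set" where
  "roof_class A X Y r = {r' \<in> roofs A X Y. roof_equiv A X Y r r'}"

text \<open>The operations on classes are given by representatives; two classes have representatives with a
  common left leg, which are used for the addition.\<close>

definition derived_hom ::
    "('k, 'a) module \<Rightarrow> ('a, 'm) cochain \<Rightarrow> ('a, 'm) cochain \<Rightarrow> ('k, ('a, 'm) roof set) module" where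
  "derived_hom A X Y = (let
       zr = roof_class A X Y (X, ch_id X, \<lambda>i. zero_map (term_at X i) (term_at Y i))
     in \<lparr>carrier = roof_class A X Y ` roofs A X Y, mult = (\<lambda>a b. zr), one = zr, zero = zr,
      add = (\<lambda>a b. {r. \<exists>Z s f g. (Z, s, f) \<in> a \<and> (Z, s, g) \<in> b \<and>
        r \<in> roof_class A X Y (Z, s, \<lambda>i. add_map (term_at Z i) (term_at Y i) (f i) (g i))}),
      smult = (\<lambda>c a. {r. \<exists>Z s f. (Z, s, f) \<in> a \<and>
        r \<in> roof_class A X Y (Z, s, \<lambda>i. scale_map A (term_at Z i) (term_at Y i) c (f i))})\<rparr>)"

definition derived_comp ::
    "('a, 'z) ring_scheme \<Rightarrow> ('a, 'm) cochain \<Rightarrow> ('a, 'm) cochain \<Rightarrow> ('a, 'm) cochain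
      \<Rightarrow> ('a, 'm) roof set \<Rightarrow> ('a, 'm) roof set \<Rightarrow> ('a, 'm) roof set" where
  "derived_comp A X Y Z b a = {r. \<exists>V s f W t g U p q. (V, s, f) \<in> a \<and> (W, t, g) \<in> b \<and>
     bounded_complex A U \<and> p \<in> quasi_isos A U V \<and> q \<in> chain_maps A U W \<and>
     homotopic A U Y (ch_comp U f p) (ch_comp U t q) \<and>
     r \<in> roof_class A X Z (U, ch_comp U s p, ch_comp U g q)}"

type_synonym ('k, 'a) dcomplex = "('a, nat \<Rightarrow> 'k) cochain"
type_synonym ('k, 'a) dmor = "('a, nat \<Rightarrow> 'k) roof set"

definition derived_cat :: "('k, 'a) module \<Rightarrow> ('k, ('k, 'a) dcomplex, ('k, 'a) dmor) lin_cat" where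
  "derived_cat A = \<lparr>Obj = {X. bounded_complex A X}, Mor = derived_hom A, Cmp = derived_comp A,
     Idt = (\<lambda>X. roof_class A X X (X, ch_id X, ch_id X))\<rparr>"

record ('o, 'f) endofun =
  fob :: "'o \<Rightarrow> 'o"
  fmor :: "'o \<Rightarrow> 'o \<Rightarrow> 'f \<Rightarrow> 'f"

definition shift :: "('a, 'm) cochain \<Rightarrow> ('a, 'm) cochain" where
  "shift X = \<lparr>term_at = (\<lambda>i. term_at X (i + 1)),
     diff_at = (\<lambda>i. \<lambda>x \<in> carrier (term_at X (i + 1)). \<ominus>\<^bsub>term_at X (i + 2)\<^esub> diff_at X (i + 1) x)\<rparr>"

definition shift_functor :: "('k, 'a) module \<Rightarrow> (('k, 'a) dcomplex, ('k, 'a) dmor) endofun" where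
  "shift_functor A = \<lparr>fob = shift,
     fmor = (\<lambda>X Y a. {r. \<exists>Z s f. (Z, s, f) \<in> a \<and>
       r \<in> roof_class A (shift X) (shift Y) (shift Z, \<lambda>i. s (i + 1), \<lambda>i. f (i + 1))})\<rparr>"


section \<open>Cluster categories and cluster-tilted algebras\<close>

definition lin_functor :: "('k, 'z) ring_scheme \<Rightarrow> ('k, 'o, 'f) lin_cat \<Rightarrow> ('o, 'f) endofun \<Rightarrow> bool" where
  "lin_functor K C F \<longleftrightarrow> (\<forall>X \<in> Obj C. fob F X \<in> Obj C \<and>
     fmor F X X (Idt C X) = Idt C (fob F X) \<and>
     (\<forall>Y \<in> Obj C. fmor F X Y \<in> module_hom K (Mor C X Y) (Mor C (fob F X) (fob F Y)) \<and>
       (\<forall>Z \<in> Obj C. \<forall>f \<in> carrier (Mor C X Y). \<forall>g \<in> carrier (Mor C Y Z).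
          fmor F X Z (Cmp C X Y Z g f)
            = Cmp C (fob F X) (fob F Y) (fob F Z) (fmor F Y Z g) (fmor F X Y f))))"

definition isos :: "('k, 'o, 'f) lin_cat \<Rightarrow> 'o \<Rightarrow> 'o \<Rightarrow> 'f set" where
  "isos C X Y = {f \<in> carrier (Mor C X Y). \<exists>g \<in> carrier (Mor C Y X).
     Cmp C X Y X g f = Idt C X \<and> Cmp C Y X Y f g = Idt C Y}"

definition lin_autoequivalence ::
    "('k, 'z) ring_scheme \<Rightarrow> ('k, 'o, 'f) lin_cat \<Rightarrow> ('o, 'f) endofun \<Rightarrow> bool" where
  "lin_autoequivalence K C F \<longleftrightarrow> lin_functor K C F \<and>
     (\<forall>X \<in> Obj C. \<forall>Y \<in> Obj C. bij_betw (fmor F X Y)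
        (carrier (Mor C X Y)) (carrier (Mor C (fob F X) (fob F Y)))) \<and>
     (\<forall>Y \<in> Obj C. \<exists>X \<in> Obj C. isos C (fob F X) Y \<noteq> {})"

definition nat_isomorphic ::
    "('k, 'o, 'f) lin_cat \<Rightarrow> ('o, 'f) endofun \<Rightarrow> ('o, 'f) endofun \<Rightarrow> bool" where
  "nat_isomorphic C F G \<longleftrightarrow> (\<exists>\<theta>. \<forall>X \<in> Obj C. \<theta> X \<in> isos C (fob F X) (fob G X) \<and>
     (\<forall>Y \<in> Obj C. \<forall>f \<in> carrier (Mor C X Y).
        Cmp C (fob F X) (fob F Y) (fob G Y) (\<theta> Y) (fmor F X Y f)
          = Cmp C (fob F X) (fob G X) (fob G Y) (fmor G X Y f) (\<theta> X)))"

definition fun_comp :: "('o, 'f) endofun \<Rightarrow> ('o, 'f) endofun \<Rightarrow> ('o, 'f) endofun" where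
  "fun_comp G F = \<lparr>fob = fob G \<circ> fob F,
     fmor = (\<lambda>X Y. fmor G (fob F X) (fob F Y) \<circ> fmor F X Y)\<rparr>"

definition dual_space :: "'k ring \<Rightarrow> ('k, 'v) module \<Rightarrow> ('k, 'v \<Rightarrow> 'k) module" where
  "dual_space K V = (let z = (\<lambda>x \<in> carrier V. \<zero>\<^bsub>K\<^esub>);
       K' = \<lparr>carrier = carrier K, mult = mult K, one = one K, zero = zero K, add = add K,
             smult = mult K\<rparr>
     in \<lparr>carrier = module_hom K V K' \<inter> extensional (carrier V), mult = (\<lambda>f g. z), one = z, zero = z,
      add = (\<lambda>f g. \<lambda>x \<in> carrier V. f x \<oplus>\<^bsub>K\<^esub> g x),
      smult = (\<lambda>c f. \<lambda>x \<in> carrier V. c \<otimes>\<^bsub>K\<^esub> f x)\<rparr>)"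

text \<open>A Serre functor \<open>S\<close> has isomorphisms \<open>Hom(X, Y) \<rightarrow> D Hom(Y, S X)\<close>, natural in \<open>X\<close> and \<open>Y\<close>.\<close>

definition serre_functor :: "'k ring \<Rightarrow> ('k, 'o, 'f) lin_cat \<Rightarrow> ('o, 'f) endofun \<Rightarrow> bool" where
  "serre_functor K C S \<longleftrightarrow> lin_autoequivalence K C S \<and> (\<exists>\<beta>.
     (\<forall>X \<in> Obj C. \<forall>Y \<in> Obj C.
        \<beta> X Y \<in> module_hom K (Mor C X Y) (dual_space K (Mor C Y (fob S X))) \<and>
        bij_betw (\<beta> X Y) (carrier (Mor C X Y)) (carrier (dual_space K (Mor C Y (fob S X))))) \<and>
     (\<forall>X \<in> Obj C. \<forall>Y \<in> Obj C. \<forall>Y' \<in> Obj C. \<forall>f \<in> carrier (Mor C X Y).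
        \<forall>g \<in> carrier (Mor C Y Y'). \<forall>h \<in> carrier (Mor C Y' (fob S X)).
        \<beta> X Y' (Cmp C X Y Y' g f) h = \<beta> X Y f (Cmp C Y Y' (fob S X) h g)) \<and>
     (\<forall>X' \<in> Obj C. \<forall>X \<in> Obj C. \<forall>Y \<in> Obj C. \<forall>u \<in> carrier (Mor C X' X).
        \<forall>f \<in> carrier (Mor C X Y). \<forall>h \<in> carrier (Mor C Y (fob S X')).
        \<beta> X' Y (Cmp C X' X Y f u) h
          = \<beta> X Y f (Cmp C Y (fob S X') (fob S X) (fmor S X' X u) h)))"

text \<open>The Auslander-Reiten translation \<open>\<tau>\<close> of the derived category is the autoequivalence for which
  \<open>\<tau>[1]\<close> is a Serre functor. It is determined up to natural isomorphism.\<close>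

definition derived_AR_translation ::
    "'k ring \<Rightarrow> ('k, 'a) module \<Rightarrow> (('k, 'a) dcomplex, ('k, 'a) dmor) endofun \<Rightarrow> bool" where
  "derived_AR_translation K A \<tau> \<longleftrightarrow> lin_autoequivalence K (derived_cat A) \<tau> \<and>
     serre_functor K (derived_cat A) (fun_comp (shift_functor A) \<tau>)"

text \<open>\<open>F\<close> is naturally isomorphic to \<open>\<tau>\<^sup>-\<^sup>1[1]\<close>.\<close>

definition cluster_functor ::
    "'k ring \<Rightarrow> ('k, 'a) module \<Rightarrow> (('k, 'a) dcomplex, ('k, 'a) dmor) endofun \<Rightarrow> bool" where
  "cluster_functor K A F \<longleftrightarrow> lin_autoequivalence K (derived_cat A) F \<and>
     (\<exists>\<tau>. derived_AR_translation K A \<tau> \<and>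
        nat_isomorphic (derived_cat A) (fun_comp \<tau> F) (shift_functor A))"

text \<open>
  The orbit category of \<open>C\<close> under an autoequivalence \<open>F\<close>: the objects are those of \<open>C\<close>, and
  \<open>Hom(X, Y)\<close> is the direct sum over \<open>i \<in> \<int>\<close> of the spaces \<open>Hom\<^sub>C(X, F\<^sup>i Y)\<close>. As \<open>F\<close> need not have
  a strict inverse, an element of \<open>Hom\<^sub>C(X, F\<^sup>i Y)\<close> is encoded as the family of its images
  \<open>f p : F\<^sup>p X \<rightarrow> F\<^sup>p\<^sup>+\<^sup>i Y\<close> for the natural numbers \<open>p\<close> with \<open>p + i \<ge> 0\<close>, so that \<open>F (f p) = f (p + 1)\<close>;
  since \<open>F\<close> is fully faithful, the family is determined by any of its members, which is arbitrary.
\<close>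

definition pow_ob :: "('o, 'f) endofun \<Rightarrow> int \<Rightarrow> 'o \<Rightarrow> 'o" where
  "pow_ob F i X = (fob F ^^ nat i) X"

definition orbit_zero :: "('k, 'o, 'f) lin_cat \<Rightarrow> ('o, 'f) endofun \<Rightarrow> 'o \<Rightarrow> 'o \<Rightarrow> int \<Rightarrow> nat \<Rightarrow> 'f" where
  "orbit_zero C F X Y = (\<lambda>i p. if int p + i \<ge> 0
     then \<zero>\<^bsub>Mor C (pow_ob F (int p) X) (pow_ob F (int p + i) Y)\<^esub> else undefined)"

definition orbit_carrier ::
    "('k, 'o, 'f) lin_cat \<Rightarrow> ('o, 'f) endofun \<Rightarrow> 'o \<Rightarrow> 'o \<Rightarrow> (int \<Rightarrow> nat \<Rightarrow> 'f) set" where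
  "orbit_carrier C F X Y = {\<phi>.
     (\<forall>i p. if int p + i \<ge> 0
        then \<phi> i p \<in> carrier (Mor C (pow_ob F (int p) X) (pow_ob F (int p + i) Y)) \<and>
          fmor F (pow_ob F (int p) X) (pow_ob F (int p + i) Y) (\<phi> i p) = \<phi> i (Suc p)
        else \<phi> i p = undefined) \<and>
     finite {i. \<phi> i \<noteq> orbit_zero C F X Y i}}"

definition orbit_hom ::
    "('k, 'o, 'f) lin_cat \<Rightarrow> ('o, 'f) endofun \<Rightarrow> 'o \<Rightarrow> 'o \<Rightarrow> ('k, int \<Rightarrow> nat \<Rightarrow> 'f) module" where
  "orbit_hom C F X Y = \<lparr>carrier = orbit_carrier C F X Y, mult = (\<lambda>\<phi> \<psi>. orbit_zero C F X Y),
     one = orbit_zero C F X Y, zero = orbit_zero C F X Y,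
     add = (\<lambda>\<phi> \<psi> i p. if int p + i \<ge> 0
       then \<phi> i p \<oplus>\<^bsub>Mor C (pow_ob F (int p) X) (pow_ob F (int p + i) Y)\<^esub> \<psi> i p else undefined),
     smult = (\<lambda>c \<phi> i p. if int p + i \<ge> 0
       then c \<odot>\<^bsub>Mor C (pow_ob F (int p) X) (pow_ob F (int p + i) Y)\<^esub> \<phi> i p else undefined)\<rparr>"

text \<open>The degree \<open>k\<close> part of \<open>\<psi> \<circ> \<phi>\<close> is the sum of the composites of \<open>\<phi> i\<close> and \<open>\<psi> (k - i)\<close>. At index
  \<open>p\<close> this can be written down once all \<open>p + i\<close> are nonnegative, which determines the family.\<close>

definition orbit_comp ::
    "('k, 'o, 'f) lin_cat \<Rightarrow> ('o, 'f) endofun \<Rightarrow> 'o \<Rightarrow> 'o \<Rightarrow> 'o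
      \<Rightarrow> (int \<Rightarrow> nat \<Rightarrow> 'f) \<Rightarrow> (int \<Rightarrow> nat \<Rightarrow> 'f) \<Rightarrow> int \<Rightarrow> nat \<Rightarrow> 'f" where
  "orbit_comp C F X Y Z \<psi> \<phi> = (THE \<omega>. \<omega> \<in> orbit_carrier C F X Z \<and>
     (let supp = {i. \<phi> i \<noteq> orbit_zero C F X Y i} in
      \<forall>k p. int p + k \<ge> 0 \<and> (\<forall>i \<in> supp. int p + i \<ge> 0) \<longrightarrow>
        \<omega> k p = (\<Oplus>\<^bsub>Mor C (pow_ob F (int p) X) (pow_ob F (int p + k) Z)\<^esub>i \<in> supp.
          Cmp C (pow_ob F (int p) X) (pow_ob F (int p + i) Y) (pow_ob F (int p + k) Z)
            (\<psi> (k - i) (nat (int p + i))) (\<phi> i p))))"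

definition orbit_cat ::
    "('k, 'o, 'f) lin_cat \<Rightarrow> ('o, 'f) endofun \<Rightarrow> ('k, 'o, int \<Rightarrow> nat \<Rightarrow> 'f) lin_cat" where
  "orbit_cat C F = \<lparr>Obj = Obj C, Mor = orbit_hom C F, Cmp = orbit_comp C F,
     Idt = (\<lambda>X i p. if i = 0 then Idt C (pow_ob F (int p) X) else orbit_zero C F X X i p)\<rparr>"

definition cluster_cat ::
    "('k, 'a) module \<Rightarrow> (('k, 'a) dcomplex, ('k, 'a) dmor) endofun
      \<Rightarrow> ('k, ('k, 'a) dcomplex, int \<Rightarrow> nat \<Rightarrow> ('k, 'a) dmor) lin_cat" where
  "cluster_cat A F = orbit_cat (derived_cat A) F"

text \<open>\<open>X\<close> is a direct summand of a finite direct sum of copies of \<open>T\<close>: the identity of \<open>X\<close> factors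
  through \<open>T\<^sup>m\<close>.\<close>

definition in_add :: "('k, 'o, 'f) lin_cat \<Rightarrow> 'o \<Rightarrow> 'o \<Rightarrow> bool" where
  "in_add C T X \<longleftrightarrow> (\<exists>m :: nat. \<exists>f g.
     (\<forall>i < m. f i \<in> carrier (Mor C X T) \<and> g i \<in> carrier (Mor C T X)) \<and>
     (\<Oplus>\<^bsub>Mor C X X\<^esub>i \<in> {..<m}. Cmp C X T X (g i) (f i)) = Idt C X)"

text \<open>There is no \<open>X \<noteq> 0\<close> such that \<open>X \<oplus> X\<close> is a direct summand of \<open>T\<close>.\<close>

definition basic_object :: "('k, 'o, 'f) lin_cat \<Rightarrow> 'o \<Rightarrow> bool" where
  "basic_object C T \<longleftrightarrow> (\<nexists>X f1 f2 g1 g2. X \<in> Obj C \<and> Idt C X \<noteq> \<zero>\<^bsub>Mor C X X\<^esub> \<and>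
     f1 \<in> carrier (Mor C X T) \<and> f2 \<in> carrier (Mor C X T) \<and>
     g1 \<in> carrier (Mor C T X) \<and> g2 \<in> carrier (Mor C T X) \<and>
     Cmp C X T X g1 f1 = Idt C X \<and> Cmp C X T X g2 f2 = Idt C X \<and>
     Cmp C X T X g1 f2 = \<zero>\<^bsub>Mor C X X\<^esub> \<and> Cmp C X T X g2 f1 = \<zero>\<^bsub>Mor C X X\<^esub>)"

definition cluster_tilting ::
    "('k, 'a) module \<Rightarrow> (('k, 'a) dcomplex, ('k, 'a) dmor) endofun \<Rightarrow> ('k, 'a) dcomplex \<Rightarrow> bool" where
  "cluster_tilting A F T \<longleftrightarrow> (let C = cluster_cat A F in T \<in> Obj C \<and>
     (\<forall>X \<in> Obj C. carrier (Mor C T (shift X)) = {\<zero>\<^bsub>Mor C T (shift X)\<^esub>} \<longleftrightarrow> in_add C T X))"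

definition End_op :: "('k, 'o, 'f) lin_cat \<Rightarrow> 'o \<Rightarrow> ('k, 'f) module" where
  "End_op C T = (Mor C T T)\<lparr>mult := (\<lambda>a b. Cmp C T T T b a), one := Idt C T\<rparr>"

definition tame_cluster_tilted :: "'k ring \<Rightarrow> ('k, 'a) module \<Rightarrow> bool" where
  "tame_cluster_tilted K A \<longleftrightarrow> (\<exists>Q F T. euclidean_quiver Q \<and> acyclic_quiver Q \<and>
     cluster_functor K (path_algebra K Q) F \<and>
     cluster_tilting (path_algebra K Q) F T \<and>
     basic_object (cluster_cat (path_algebra K Q) F) T \<and>
     algebra_iso K A (End_op (cluster_cat (path_algebra K Q) F) T))"

end

theory Submission
  imports Defs
begin

text \<open>
  The two wall-and-chamber structures agree cone by cone: \<open>D\<^bsub>v\<^sup>\<bottom>\<^esub>(X) = D\<^bsub>0,v\<^esub>(X)\<close> as soon as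
  \<open>v \<in> D(X)\<close> (\<open>D_perp_eq_D_inf\<close>). Both cones are cut out by inequalities indexed by the submodules
  \<open>X'\<close> of \<open>X\<close>. If \<open>v \<cdot> dim X' = 0\<close>, the inequality \<open>(v + \<epsilon>w) \<cdot> dim X' \<le> 0\<close> says \<open>w \<cdot> dim X' \<le> 0\<close> for
  every \<open>\<epsilon> > 0\<close>. If \<open>v \<cdot> dim X' < 0\<close>, it holds for all sufficiently small \<open>\<epsilon> > 0\<close>, whatever \<open>w\<close> is.
  One \<open>\<epsilon>\<close> can serve all submodules at once because their dimension vectors form a finite set
  (\<open>finite_submodule_dimvecs\<close>); this is where finite dimensionality enters.

  For the finiteness, \<open>Hom(P(i), X')\<close> is a subspace of \<open>Hom(P(i), X)\<close>, so its dimension is one of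
  finitely many natural numbers once \<open>Hom(P(i), X)\<close> is known to be finite dimensional. Evaluations
  at finitely many generators of \<open>P(i)\<close> are jointly injective on \<open>Hom(P(i), X)\<close> and take values in
  \<open>X\<close>, which is spanned over \<open>K\<close> by the products of a spanning set of the algebra with generators
  of \<open>X\<close>.

  For the regular picture, let \<open>g \<in> D(X)\<close>. A submodule of a submodule of \<open>X\<close> is a submodule
  of \<open>X\<close>, so a nonzero \<open>X' \<subseteq> X\<close> is regular exactly when \<open>g \<cdot> dim X' = 0\<close>. Hence the regular domain of
  \<open>X\<close> is the cone \<open>D\<^bsub>g\<^sup>\<bottom>\<^esub>(X)\<close> (\<open>regular_domain_eq_D_perp\<close>), and the first part applies at \<open>g\<close>.
\<close>

section \<open>Finite dimensional vector spaces\<close>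

text \<open>A linearly independent subset of \<open>M\<close> of the largest possible size spans \<open>M\<close>. As \<open>M\<close> is an
  arbitrary subset, this provides bases of subspaces, and bases of images of linear maps whose
  members can be lifted.\<close>

lemma (in vectorspace) subset_spanned_by_independent:
  assumes fd: "fin_dim" and M: "M \<subseteq> carrier V"
  shows "\<exists>F. finite F \<and> F \<subseteq> M \<and> lin_indpt F \<and> M \<subseteq> span F"
proof -
  have "\<exists>F. finite F \<and> maximal F (\<lambda>B. B \<subseteq> M \<and> lin_indpt B)"
  proof (rule maximal_exists)
    show "finite B \<and> card B \<le> dim" if "B \<subseteq> M \<and> lin_indpt B" for B
      using that M li_le_dim[OF fd, of B] by blast
    show "{} \<subseteq> M \<and> lin_indpt {}"
      by (simp add: lin_dep_def)
  qed
  then obtain F where fin: "finite F" and max: "maximal F (\<lambda>B. B \<subseteq> M \<and> lin_indpt B)"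
    by blast
  have F: "F \<subseteq> M" "lin_indpt F"
    using max by (auto simp: maximal_def)
  have "x \<in> span F" if x: "x \<in> M" for x
  proof (cases "x \<in> F")
    case True
    then show ?thesis using in_own_span[of F] F M by blast
  next
    case False
    have "lin_dep (F \<union> {x})"
    proof (rule ccontr)
      assume "\<not> lin_dep (F \<union> {x})"
      moreover have "F \<union> {x} \<subseteq> M" using F x by blast
      ultimately have "F \<union> {x} = F" using max unfolding maximal_def by blast
      then show False using False by blast
    qed
    then show ?thesis
      using lin_dep_iff_in_span[of F x] F M x False by blast
  qed
  then show ?thesis using fin F by blast
qed

lemma (in vectorspace) subspace_dim_le:
  assumes fd: "fin_dim" and W: "submodule K W V"
  shows "vectorspace.dim K (vs W) \<le> dim"
proof -
  have sW: "subspace K W V"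
    using W vectorspace_axioms by (simp add: subspace_def)
  interpret W: vectorspace K "vs W" using subspace_is_vs[OF sW] .
  have WV: "W \<subseteq> carrier V" using W by (simp add: submodule_def)
  obtain F where F: "finite F" "F \<subseteq> W" "lin_indpt F" "W \<subseteq> span F"
    using subset_spanned_by_independent[OF fd WV] by blast
  have "span F = W"
    using span_is_subset[OF F(2) W] F(4) by blast
  then have "W.span F = carrier (vs W)"
    using span_li_not_depend(1)[OF F(2) W] by simp
  then have "W.dim \<le> card F"
    using W.gen_ge_dim[of F] F by simp
  also have "\<dots> \<le> dim"
    using li_le_dim(2)[OF fd _ F(3)] F(2) WV by blast
  finally show ?thesis .
qed

text \<open>The finiteness half of rank-nullity: lifts of a basis of \<open>T ` N\<close>, together with vectors spanning
  the kernel of \<open>T\<close> on \<open>N\<close>, span \<open>N\<close>. Speaking of spans in the ambient space \<open>V\<close> allows this to be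
  iterated over a chain of subspaces of \<open>V\<close>.\<close>

lemma spanned_if_kernel_spanned:
  assumes T: "linear_map K V W T"
    and fd: "vectorspace.fin_dim K W" and N: "submodule K N V"
    and C: "finite C" "C \<subseteq> carrier V"
    and ker: "\<And>x. x \<in> N \<Longrightarrow> T x = \<zero>\<^bsub>W\<^esub> \<Longrightarrow> x \<in> module.span K V C"
  shows "\<exists>C'. finite C' \<and> C' \<subseteq> carrier V \<and> N \<subseteq> module.span K V C'"
proof -
  interpret V: vectorspace K V using T by (simp add: linear_map_def)
  interpret W: vectorspace K W using T by (simp add: linear_map_def)
  interpret T: linear_map K V W T by fact
  have NV: "N \<subseteq> carrier V" using N by (simp add: submodule_def)
  have "T ` N \<subseteq> carrier W" using NV by auto
  from W.subset_spanned_by_independent[OF fd this]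
  obtain F where F: "finite F" "F \<subseteq> T ` N" "T ` N \<subseteq> W.span F" by blast
  from F(1,2) obtain G where G: "finite G" "G \<subseteq> N" "F = T ` G"
    by (meson finite_subset_image)
  have GV: "G \<subseteq> carrier V" using G NV by blast
  let ?C = "C \<union> G"
  have CG: "?C \<subseteq> carrier V" using C GV by blast
  have sub: "submodule K (V.span ?C) V" by (rule V.span_is_submodule[OF CG])
  have sG: "submodule K (V.span G) V" by (rule V.span_is_submodule[OF GV])
  have GN: "V.span G \<subseteq> N" by (rule V.span_is_subset[OF G(2) N])
  have spGV: "V.span G \<subseteq> carrier V" using GN NV by blast
  have img: "submodule K (T ` V.span G) W"
  proof (unfold submodule_def, intro conjI allI impI)
    show "module K W" by unfold_locales
    show "T ` V.span G \<subseteq> carrier W" using spGV by auto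
    have "\<zero>\<^bsub>V\<^esub> \<in> V.span G" using sG by (simp add: submodule_def)
    then show "\<zero>\<^bsub>W\<^esub> \<in> T ` V.span G" by (metis T.T0_is_0 imageI)
    show "a \<oplus>\<^bsub>W\<^esub> b \<in> T ` V.span G" if ab: "a \<in> T ` V.span G" "b \<in> T ` V.span G" for a b
    proof -
      obtain x y where xy: "x \<in> V.span G" "y \<in> V.span G" "a = T x" "b = T y" using ab by blast
      then have "a \<oplus>\<^bsub>W\<^esub> b = T (x \<oplus>\<^bsub>V\<^esub> y)" using spGV by (simp add: subset_iff)
      moreover have "x \<oplus>\<^bsub>V\<^esub> y \<in> V.span G" using sG xy by (simp add: submodule_def)
      ultimately show ?thesis by blast
    qed
    show "c \<odot>\<^bsub>W\<^esub> a \<in> T ` V.span G" if c: "c \<in> carrier K" and a: "a \<in> T ` V.span G" for c a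
    proof -
      obtain x where x: "x \<in> V.span G" "a = T x" using a by blast
      then have "c \<odot>\<^bsub>W\<^esub> a = T (c \<odot>\<^bsub>V\<^esub> x)" using spGV c by (simp add: subset_iff)
      moreover have "c \<odot>\<^bsub>V\<^esub> x \<in> V.span G" using sG x c by (simp add: submodule_def)
      ultimately show ?thesis by blast
    qed
  qed
  have "F \<subseteq> T ` V.span G" using G(3) V.in_own_span[OF GV] by blast
  then have TN: "T ` N \<subseteq> T ` V.span G"
    using W.span_is_subset[OF _ img] F(3) by blast
  have "x \<in> V.span ?C" if x: "x \<in> N" for x
  proof -
    obtain y where y: "y \<in> V.span G" "T x = T y" using TN x by blast
    have xV: "x \<in> carrier V" "y \<in> carrier V" using x y NV spGV by auto
    have "y \<in> N" using y GN by blast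
    then have "(\<ominus>\<^bsub>K\<^esub> \<one>\<^bsub>K\<^esub>) \<odot>\<^bsub>V\<^esub> y \<in> N" using N by (simp add: submodule_def)
    then have "x \<ominus>\<^bsub>V\<^esub> y \<in> N"
      using N x xV by (simp add: submodule_def a_minus_def V.smult_minus_1)
    moreover have "T (x \<ominus>\<^bsub>V\<^esub> y) = \<zero>\<^bsub>W\<^esub>"
      using xV y(2) by (simp add: T.T_minus W.r_neg a_minus_def)
    ultimately have "x \<ominus>\<^bsub>V\<^esub> y \<in> V.span C" by (rule ker)
    then have "x \<ominus>\<^bsub>V\<^esub> y \<in> V.span ?C" "y \<in> V.span ?C"
      using V.span_is_monotone[of C ?C] V.span_is_monotone[of G ?C] y(1) by auto
    then have "(x \<ominus>\<^bsub>V\<^esub> y) \<oplus>\<^bsub>V\<^esub> y \<in> V.span ?C" using sub by (simp add: submodule_def)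
    moreover have "(x \<ominus>\<^bsub>V\<^esub> y) \<oplus>\<^bsub>V\<^esub> y = x"
      using xV by (simp add: a_minus_def V.a_assoc V.l_neg)
    ultimately show ?thesis by simp
  qed
  then show ?thesis using C G CG by blast
qed

text \<open>Descending induction on the common kernels \<open>N U\<close> of the maps indexed by \<open>U \<subseteq> S\<close>: the kernel for
  \<open>S\<close> is zero, each map dropped enlarges a finitely spanned subspace by a finitely spanned one,
  and the kernel for the empty set is the whole space.\<close>

lemma fin_dim_if_jointly_injective:
  assumes V: "vectorspace K V" and W: "vectorspace K W" and fd: "vectorspace.fin_dim K W"
    and S: "finite S" and T: "\<And>s. s \<in> S \<Longrightarrow> T s \<in> module_hom K V W"
    and inj: "\<And>x. x \<in> carrier V \<Longrightarrow> (\<And>s. s \<in> S \<Longrightarrow> T s x = \<zero>\<^bsub>W\<^esub>) \<Longrightarrow> x = \<zero>\<^bsub>V\<^esub>"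
  shows "vectorspace.fin_dim K V"
proof -
  interpret V: vectorspace K V by fact
  interpret W: vectorspace K W by fact
  have lin: "linear_map K V W (T s)" if "s \<in> S" for s
    by (intro linear_map.intro mod_hom.intro mod_hom_axioms.intro T that) unfold_locales
  define N where "N U = {x \<in> carrier V. \<forall>s \<in> U. T s x = \<zero>\<^bsub>W\<^esub>}" for U
  have subN: "submodule K (N U) V" if "U \<subseteq> S" for U
  proof (unfold submodule_def, intro conjI allI impI)
    show "module K V" by unfold_locales
    have z: "T s \<zero>\<^bsub>V\<^esub> = \<zero>\<^bsub>W\<^esub>" if "s \<in> U" for s
      using lin \<open>U \<subseteq> S\<close> that by (meson linear_map.T0_is_0 subsetD)
    then show "\<zero>\<^bsub>V\<^esub> \<in> N U" by (simp add: N_def)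
  next
    fix x y assume "x \<in> N U" "y \<in> N U"
    then show "x \<oplus>\<^bsub>V\<^esub> y \<in> N U"
      using T that by (auto simp: N_def module_hom_add[of _ K V W] subset_iff)
  next
    fix c x assume "c \<in> carrier K" "x \<in> N U"
    then show "c \<odot>\<^bsub>V\<^esub> x \<in> N U"
      using T that by (auto simp: N_def module_hom_smult[of _ K V W] subset_iff)
  qed (auto simp: N_def)
  have "\<exists>C. finite C \<and> C \<subseteq> carrier V \<and> N (S - U) \<subseteq> V.span C" if "finite U" "U \<subseteq> S" for U
    using that
  proof (induction U rule: finite_induct)
    case empty
    have "N (S - {}) \<subseteq> {\<zero>\<^bsub>V\<^esub>}" using inj by (auto simp: N_def)
    also have "\<dots> \<subseteq> V.span {}"
      using V.span_is_submodule[of "{}"] by (simp add: submodule_def)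
    finally show ?case by blast
  next
    case (insert u U)
    then obtain C where C: "finite C" "C \<subseteq> carrier V" "N (S - U) \<subseteq> V.span C" by auto
    have u: "u \<in> S" using insert by blast
    show ?case
    proof (rule spanned_if_kernel_spanned[OF lin[OF u] fd _ C(1,2)])
      show "submodule K (N (S - insert u U)) V" by (rule subN) blast
      fix x assume "x \<in> N (S - insert u U)" "T u x = \<zero>\<^bsub>W\<^esub>"
      then have "x \<in> N (S - U)" by (auto simp: N_def)
      then show "x \<in> V.span C" using C by blast
    qed
  qed
  from this[OF S] obtain C where C: "finite C" "C \<subseteq> carrier V" "N {} \<subseteq> V.span C" by auto
  have "carrier V \<subseteq> V.span C" using C(3) by (simp add: N_def)
  then have "V.span C = carrier V" using V.span_is_subset2[OF C(2)] by blast
  then show ?thesis using C V.fin_dim_def by blast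
qed


section \<open>Modules over an algebra as vector spaces\<close>

context left_module
begin

lemma smult_zero_right:
  assumes a: "a \<in> carrier A"
  shows "a \<odot>\<^bsub>M\<^esub> \<zero>\<^bsub>M\<^esub> = \<zero>\<^bsub>M\<^esub>"
proof -
  have "a \<odot>\<^bsub>M\<^esub> \<zero>\<^bsub>M\<^esub> \<oplus>\<^bsub>M\<^esub> a \<odot>\<^bsub>M\<^esub> \<zero>\<^bsub>M\<^esub> = a \<odot>\<^bsub>M\<^esub> \<zero>\<^bsub>M\<^esub>"
    using smult_r_distr[OF a M.zero_closed M.zero_closed] by simp
  then show ?thesis using smult_closed[OF a M.zero_closed] by (metis M.add.r_cancel_one')
qed

lemma smult_zero_left:
  assumes x: "x \<in> carrier M"
  shows "\<zero>\<^bsub>A\<^esub> \<odot>\<^bsub>M\<^esub> x = \<zero>\<^bsub>M\<^esub>"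
proof -
  have "\<zero>\<^bsub>A\<^esub> \<odot>\<^bsub>M\<^esub> x \<oplus>\<^bsub>M\<^esub> \<zero>\<^bsub>A\<^esub> \<odot>\<^bsub>M\<^esub> x = \<zero>\<^bsub>A\<^esub> \<odot>\<^bsub>M\<^esub> x"
    using smult_l_distr[OF A.zero_closed A.zero_closed x] by simp
  then show ?thesis using smult_closed[OF A.zero_closed x] by (metis M.add.r_cancel_one')
qed

lemma smult_minus_right:
  assumes a: "a \<in> carrier A" and x: "x \<in> carrier M"
  shows "a \<odot>\<^bsub>M\<^esub> (\<ominus>\<^bsub>M\<^esub> x) = \<ominus>\<^bsub>M\<^esub> (a \<odot>\<^bsub>M\<^esub> x)"
proof -
  have "a \<odot>\<^bsub>M\<^esub> (\<ominus>\<^bsub>M\<^esub> x) \<oplus>\<^bsub>M\<^esub> a \<odot>\<^bsub>M\<^esub> x = \<zero>\<^bsub>M\<^esub>"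
    using smult_r_distr[OF a _ x, of "\<ominus>\<^bsub>M\<^esub> x"] x smult_zero_right[OF a] by (simp add: M.l_neg)
  then show ?thesis using smult_closed[OF a] x by (metis M.a_inv_closed M.minus_equality)
qed

end

text \<open>An additive subgroup is also closed under negatives; here that follows from
  \<open>\<ominus> x = (\<ominus> 1) x\<close>.\<close>

lemma submod_iff:
  assumes "left_module A M"
  shows "submod A M N \<longleftrightarrow> N \<subseteq> carrier M \<and> \<zero>\<^bsub>M\<^esub> \<in> N \<and> (\<forall>x \<in> N. \<forall>y \<in> N. x \<oplus>\<^bsub>M\<^esub> y \<in> N) \<and>
    (\<forall>a \<in> carrier A. \<forall>x \<in> N. a \<odot>\<^bsub>M\<^esub> x \<in> N)"
proof -
  interpret M: left_module A M by fact
  have inv: "\<ominus>\<^bsub>M\<^esub> x = (\<ominus>\<^bsub>A\<^esub> \<one>\<^bsub>A\<^esub>) \<odot>\<^bsub>M\<^esub> x" if x: "x \<in> carrier M" for x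
  proof (rule M.M.minus_equality)
    show "(\<ominus>\<^bsub>A\<^esub> \<one>\<^bsub>A\<^esub>) \<odot>\<^bsub>M\<^esub> x \<oplus>\<^bsub>M\<^esub> x = \<zero>\<^bsub>M\<^esub>"
      using M.smult_l_distr[of "\<ominus>\<^bsub>A\<^esub> \<one>\<^bsub>A\<^esub>" "\<one>\<^bsub>A\<^esub>" x] x
      by (simp add: M.smult_one M.A.l_neg M.smult_zero_left)
  qed (use x in \<open>auto intro: M.smult_closed\<close>)
  show ?thesis (is "_ \<longleftrightarrow> ?closed")
  proof
    assume "submod A M N"
    then show ?closed
      by (auto simp: submod_def Module.submodule_def subgroup_def submodule_axioms_def)
  next
    assume closed: ?closed
    then have "\<ominus>\<^bsub>M\<^esub> x \<in> N" if "x \<in> N" for x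
      using inv[of x] that by auto
    with closed show "submod A M N"
      by (auto simp: submod_def Module.submodule_def subgroup_def submodule_axioms_def
          a_inv_def[symmetric])
  qed
qed

text \<open>The \<open>K\<close>-space underlying an \<open>A\<close>-module: restriction of scalars along \<open>K \<rightarrow> A\<close>, \<open>c \<mapsto> c 1\<close>.\<close>

definition scalar_space :: "('k, 'a) module \<Rightarrow> ('a, 'm) module \<Rightarrow> ('k, 'm) module" where
  "scalar_space A M = \<lparr>carrier = carrier M, mult = mult M, one = one M, zero = zero M, add = add M,
     smult = (\<lambda>c x. (c \<odot>\<^bsub>A\<^esub> \<one>\<^bsub>A\<^esub>) \<odot>\<^bsub>M\<^esub> x)\<rparr>"

lemma scalar_space_simps [simp]:
  "carrier (scalar_space A M) = carrier M" "zero (scalar_space A M) = zero M"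
  "add (scalar_space A M) = add M" "smult (scalar_space A M) = (\<lambda>c x. (c \<odot>\<^bsub>A\<^esub> \<one>\<^bsub>A\<^esub>) \<odot>\<^bsub>M\<^esub> x)"
  by (simp_all add: scalar_space_def)

locale fd_alg =
  fixes K :: "'k ring" and A :: "('k, 'a) module"
  assumes fd_algebra: "fd_algebra K A"
begin

sublocale V: vectorspace K A
  using fd_algebra by (simp add: fd_algebra_def)

sublocale R: ring A
  using fd_algebra by (simp add: fd_algebra_def)

lemma mult_scalar_left:
  "\<lbrakk>c \<in> carrier K; x \<in> carrier A; y \<in> carrier A\<rbrakk> \<Longrightarrow> (c \<odot>\<^bsub>A\<^esub> x) \<otimes>\<^bsub>A\<^esub> y = c \<odot>\<^bsub>A\<^esub> (x \<otimes>\<^bsub>A\<^esub> y)"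
  and mult_scalar_right:
  "\<lbrakk>c \<in> carrier K; x \<in> carrier A; y \<in> carrier A\<rbrakk> \<Longrightarrow> x \<otimes>\<^bsub>A\<^esub> (c \<odot>\<^bsub>A\<^esub> y) = c \<odot>\<^bsub>A\<^esub> (x \<otimes>\<^bsub>A\<^esub> y)"
  using fd_algebra by (simp_all add: fd_algebra_def)

lemma scalar_one_closed: "c \<in> carrier K \<Longrightarrow> c \<odot>\<^bsub>A\<^esub> \<one>\<^bsub>A\<^esub> \<in> carrier A"
  by simp

lemma scalar_one_central:
  "c \<in> carrier K \<Longrightarrow> a \<in> carrier A \<Longrightarrow> (c \<odot>\<^bsub>A\<^esub> \<one>\<^bsub>A\<^esub>) \<otimes>\<^bsub>A\<^esub> a = a \<otimes>\<^bsub>A\<^esub> (c \<odot>\<^bsub>A\<^esub> \<one>\<^bsub>A\<^esub>)"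
  by (simp add: mult_scalar_left mult_scalar_right)

lemma scalar_one_mult:
  "c \<in> carrier K \<Longrightarrow> d \<in> carrier K \<Longrightarrow>
     (c \<otimes>\<^bsub>K\<^esub> d) \<odot>\<^bsub>A\<^esub> \<one>\<^bsub>A\<^esub> = (c \<odot>\<^bsub>A\<^esub> \<one>\<^bsub>A\<^esub>) \<otimes>\<^bsub>A\<^esub> (d \<odot>\<^bsub>A\<^esub> \<one>\<^bsub>A\<^esub>)"
  by (simp add: mult_scalar_left V.smult_assoc1)

lemma scalar_action_commutes:
  assumes M: "left_module A M" and c: "c \<in> carrier K" and a: "a \<in> carrier A" and x: "x \<in> carrier M"
  shows "(c \<odot>\<^bsub>A\<^esub> \<one>\<^bsub>A\<^esub>) \<odot>\<^bsub>M\<^esub> (a \<odot>\<^bsub>M\<^esub> x) = a \<odot>\<^bsub>M\<^esub> ((c \<odot>\<^bsub>A\<^esub> \<one>\<^bsub>A\<^esub>) \<odot>\<^bsub>M\<^esub> x)"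
  using left_module.smult_assoc[OF M scalar_one_closed[OF c] a x]
    left_module.smult_assoc[OF M a scalar_one_closed[OF c] x]
    scalar_one_central[OF c a] by simp

lemma scalar_space_vectorspace:
  assumes M: "left_module A M"
  shows "vectorspace K (scalar_space A M)"
proof -
  interpret M: left_module A M by fact
  show ?thesis
  proof (rule vs_criteria, goal_cases)
    case 1 show ?case by unfold_locales
  next
    case 4 show ?case
      using M.M.r_neg M.M.a_inv_closed by (metis scalar_space_simps(1-3))
  next
    case 9 show ?case by (simp add: scalar_one_mult M.smult_assoc)
  next
    case 10 show ?case by (simp add: M.smult_one)
  next
    case 11 show ?case by (simp add: V.smult_l_distr M.smult_l_distr)
  next
    case 12 show ?case by (simp add: M.smult_r_distr)
  next
    case 6 show ?case by (simp add: M.M.a_comm)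
  next
    case 7 show ?case by (simp add: M.M.a_assoc)
  qed (simp_all add: M.smult_closed)
qed

text \<open>If \<open>B\<close> spans \<open>A\<close> over \<open>K\<close> and \<open>S\<close> generates \<open>M\<close> over \<open>A\<close>, the products \<open>b s\<close> span \<open>M\<close> over
  \<open>K\<close>: their span is an \<open>A\<close>-submodule containing \<open>S\<close>. Its closure under \<open>A\<close> rests on the image of
  \<open>K\<close> being central in \<open>A\<close>.\<close>

lemma scalar_space_fin_dim:
  assumes M: "M \<in> fg_mod A"
  shows "vectorspace.fin_dim K (scalar_space A M)"
proof -
  have lM: "left_module A M" using M by (simp add: fg_mod_def)
  interpret M: left_module A M by fact
  interpret X: vectorspace K "scalar_space A M" by (rule scalar_space_vectorspace[OF lM])
  obtain S where S: "finite S" "S \<subseteq> carrier M"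
    and gen: "\<And>N. submod A M N \<Longrightarrow> S \<subseteq> N \<Longrightarrow> N = carrier M"
    using M by (auto simp: fg_mod_def)
  have "V.fin_dim" using fd_algebra by (simp add: fd_algebra_def)
  then obtain B where B: "finite B" "B \<subseteq> carrier A" "V.span B = carrier A"
    by (auto simp: V.fin_dim_def)
  define E where "E = (\<lambda>(b, s). b \<odot>\<^bsub>M\<^esub> s) ` (B \<times> S)"
  have E: "finite E" "E \<subseteq> carrier M"
    using B S by (auto simp: E_def intro!: M.smult_closed)
  let ?L = "X.span E"
  have L: "submodule K ?L (scalar_space A M)" using E by (intro X.span_is_submodule) simp
  have LM: "?L \<subseteq> carrier M"
    and L0: "\<zero>\<^bsub>M\<^esub> \<in> ?L"
    and Ladd: "\<And>x y. x \<in> ?L \<Longrightarrow> y \<in> ?L \<Longrightarrow> x \<oplus>\<^bsub>M\<^esub> y \<in> ?L"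
    and Lsm: "\<And>c x. c \<in> carrier K \<Longrightarrow> x \<in> ?L \<Longrightarrow> (c \<odot>\<^bsub>A\<^esub> \<one>\<^bsub>A\<^esub>) \<odot>\<^bsub>M\<^esub> x \<in> ?L"
    using L by (simp_all add: submodule_def)
  have EL: "E \<subseteq> ?L" using E by (intro X.in_own_span) simp
  \<comment> \<open>Each \<open>A s\<close> lies in the span, since the \<open>a\<close> with \<open>a s\<close> in it form a subspace containing \<open>B\<close>.\<close>
  have AS: "a \<odot>\<^bsub>M\<^esub> s \<in> ?L" if a: "a \<in> carrier A" and s: "s \<in> S" for a s
  proof -
    have sM: "s \<in> carrier M" using s S by blast
    let ?I = "{a \<in> carrier A. a \<odot>\<^bsub>M\<^esub> s \<in> ?L}"
    have sc: "(c \<odot>\<^bsub>A\<^esub> b) \<odot>\<^bsub>M\<^esub> s = (c \<odot>\<^bsub>A\<^esub> \<one>\<^bsub>A\<^esub>) \<odot>\<^bsub>M\<^esub> (b \<odot>\<^bsub>M\<^esub> s)"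
      if "c \<in> carrier K" "b \<in> carrier A" for c b
      using M.smult_assoc[of "c \<odot>\<^bsub>A\<^esub> \<one>\<^bsub>A\<^esub>" b s] that sM by (simp add: mult_scalar_left)
    have "submodule K ?I A"
      unfolding submodule_def
      using V.module_axioms sM L0 Ladd Lsm
      by (auto simp: M.smult_zero_left M.smult_l_distr sc)
    moreover have "B \<subseteq> ?I" using B EL s by (auto simp: E_def)
    ultimately have "V.span B \<subseteq> ?I" by (intro V.span_is_subset)
    then show ?thesis using B a by blast
  qed
  have AL: "a \<odot>\<^bsub>M\<^esub> x \<in> ?L" if a: "a \<in> carrier A" and x: "x \<in> ?L" for a x
  proof -
    let ?J = "{x \<in> carrier M. a \<odot>\<^bsub>M\<^esub> x \<in> ?L}"
    have "submodule K ?J (scalar_space A M)"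
      unfolding submodule_def
      using X.module_axioms a L0 Ladd Lsm
      by (auto simp: M.smult_zero_right M.smult_r_distr M.smult_closed
          scalar_action_commutes[OF lM, symmetric])
    moreover have "E \<subseteq> ?J"
    proof
      fix e assume "e \<in> E"
      then obtain b s where e: "b \<in> B" "s \<in> S" "e = b \<odot>\<^bsub>M\<^esub> s" by (auto simp: E_def)
      have b: "b \<in> carrier A" and sM: "s \<in> carrier M" using e B S by auto
      have "a \<odot>\<^bsub>M\<^esub> e = (a \<otimes>\<^bsub>A\<^esub> b) \<odot>\<^bsub>M\<^esub> s"
        unfolding e(3) by (rule M.smult_assoc[OF a b sM, symmetric])
      also have "\<dots> \<in> ?L" using AS[OF R.m_closed[OF a b] e(2)] .
      finally show "e \<in> ?J" using \<open>e \<in> E\<close> E by blast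
    qed
    ultimately have "?L \<subseteq> ?J" by (intro X.span_is_subset)
    then show ?thesis using x by blast
  qed
  have "submod A M ?L"
    using LM L0 Ladd AL by (simp add: submod_iff[OF lM])
  moreover have "S \<subseteq> ?L"
  proof
    fix s assume s: "s \<in> S"
    then show "s \<in> ?L" using AS[OF R.one_closed s] S M.smult_one by auto
  qed
  ultimately have "?L = carrier M" by (rule gen)
  then show ?thesis using E X.fin_dim_def by auto
qed


end

lemma lhom_iff:
  "f \<in> lhom A M N \<longleftrightarrow> f \<in> carrier M \<rightarrow> carrier N \<and>
     (\<forall>x \<in> carrier M. \<forall>y \<in> carrier M. f (x \<oplus>\<^bsub>M\<^esub> y) = f x \<oplus>\<^bsub>N\<^esub> f y) \<and>
     (\<forall>a \<in> carrier A. \<forall>x \<in> carrier M. f (a \<odot>\<^bsub>M\<^esub> x) = a \<odot>\<^bsub>N\<^esub> f x) \<and> f \<in> extensional (carrier M)"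
  by (auto simp: lhom_def module_hom_def)

lemma lhom_closed: "f \<in> lhom A M N \<Longrightarrow> x \<in> carrier M \<Longrightarrow> f x \<in> carrier N"
  by (auto simp: lhom_iff)

lemma lhom_ext:
  assumes "f \<in> lhom A M N" "g \<in> lhom A M N" "\<And>x. x \<in> carrier M \<Longrightarrow> f x = g x"
  shows "f = g"
  using assms by (intro extensionalityI[of f "carrier M" g]) (auto simp: lhom_iff)

lemma hom_space_simps [simp]:
  "carrier (hom_space A M N) = lhom A M N" "zero (hom_space A M N) = zero_map M N"
  "add (hom_space A M N) = add_map M N" "smult (hom_space A M N) = scale_map A M N"
  by (simp_all add: hom_space_def)

context fd_alg
begin

context
  fixes M :: "('a, 'm) module" and N :: "('a, 'n) module"
  assumes M: "left_module A M" and N: "left_module A N"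
begin

interpretation M: left_module A M by (rule M)
interpretation N: left_module A N by (rule N)

lemma zero_map_lhom: "zero_map M N \<in> lhom A M N"
  by (auto simp: lhom_iff zero_map_def N.smult_zero_right M.smult_closed)

lemma add_map_lhom:
  assumes f: "f \<in> lhom A M N" and g: "g \<in> lhom A M N"
  shows "add_map M N f g \<in> lhom A M N"
proof -
  have "f (x \<oplus>\<^bsub>M\<^esub> y) \<oplus>\<^bsub>N\<^esub> g (x \<oplus>\<^bsub>M\<^esub> y) = (f x \<oplus>\<^bsub>N\<^esub> g x) \<oplus>\<^bsub>N\<^esub> (f y \<oplus>\<^bsub>N\<^esub> g y)"
    if "x \<in> carrier M" "y \<in> carrier M" for x y
    using f g that lhom_closed[OF f] lhom_closed[OF g]
    by (simp add: lhom_iff N.M.a_ac)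
  moreover have "f (a \<odot>\<^bsub>M\<^esub> x) \<oplus>\<^bsub>N\<^esub> g (a \<odot>\<^bsub>M\<^esub> x) = a \<odot>\<^bsub>N\<^esub> (f x \<oplus>\<^bsub>N\<^esub> g x)"
    if "a \<in> carrier A" "x \<in> carrier M" for a x
    using f g that lhom_closed[OF f] lhom_closed[OF g]
    by (simp add: lhom_iff N.smult_r_distr)
  ultimately show ?thesis
    unfolding lhom_iff[of "add_map M N f g"]
    using lhom_closed[OF f] lhom_closed[OF g] by (simp add: add_map_def M.smult_closed)
qed

lemma scale_map_lhom:
  assumes c: "c \<in> carrier K" and f: "f \<in> lhom A M N"
  shows "scale_map A M N c f \<in> lhom A M N"
proof -
  have "(c \<odot>\<^bsub>A\<^esub> \<one>\<^bsub>A\<^esub>) \<odot>\<^bsub>N\<^esub> f (x \<oplus>\<^bsub>M\<^esub> y) =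
      (c \<odot>\<^bsub>A\<^esub> \<one>\<^bsub>A\<^esub>) \<odot>\<^bsub>N\<^esub> f x \<oplus>\<^bsub>N\<^esub> (c \<odot>\<^bsub>A\<^esub> \<one>\<^bsub>A\<^esub>) \<odot>\<^bsub>N\<^esub> f y"
    if "x \<in> carrier M" "y \<in> carrier M" for x y
    using f c that lhom_closed[OF f] by (simp add: lhom_iff N.smult_r_distr)
  moreover have "(c \<odot>\<^bsub>A\<^esub> \<one>\<^bsub>A\<^esub>) \<odot>\<^bsub>N\<^esub> f (a \<odot>\<^bsub>M\<^esub> x) = a \<odot>\<^bsub>N\<^esub> ((c \<odot>\<^bsub>A\<^esub> \<one>\<^bsub>A\<^esub>) \<odot>\<^bsub>N\<^esub> f x)"
    if "a \<in> carrier A" "x \<in> carrier M" for a x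
    using f that scalar_action_commutes[OF N c that(1) lhom_closed[OF f that(2)]]
    by (simp add: lhom_iff)
  ultimately show ?thesis
    unfolding lhom_iff[of "scale_map A M N c f"]
    using lhom_closed[OF f] c by (simp add: scale_map_def M.smult_closed N.smult_closed)
qed

lemma neg_lhom: "f \<in> lhom A M N \<Longrightarrow> (\<lambda>x \<in> carrier M. \<ominus>\<^bsub>N\<^esub> f x) \<in> lhom A M N"
  by (auto simp: lhom_iff M.smult_closed N.smult_minus_right Pi_iff N.M.minus_add)

text \<open>A scalar multiple of an \<open>A\<close>-linear map is again \<open>A\<close>-linear because the image of \<open>K\<close> in \<open>A\<close> is
  central.\<close>

lemma hom_space_vectorspace: "vectorspace K (hom_space A M N)"
proof (rule vs_criteria, goal_cases)
  case 1 show ?case by unfold_locales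
next
  case 2 show ?case by (simp add: zero_map_lhom)
next
  case 3 show ?case by (simp add: add_map_lhom)
next
  case 4 show ?case
  proof
    fix f assume "f \<in> carrier (hom_space A M N)"
    then have f: "f \<in> lhom A M N" by simp
    have "add_map M N f (\<lambda>x \<in> carrier M. \<ominus>\<^bsub>N\<^esub> f x) = zero_map M N"
      by (rule lhom_ext[OF add_map_lhom[OF f neg_lhom[OF f]] zero_map_lhom])
        (simp add: add_map_def zero_map_def N.M.r_neg lhom_closed[OF f])
    then show "\<exists>g \<in> carrier (hom_space A M N). f \<oplus>\<^bsub>hom_space A M N\<^esub> g = \<zero>\<^bsub>hom_space A M N\<^esub>"
      using neg_lhom[OF f] by auto
  qed
next
  case 5 show ?case by (simp add: scale_map_lhom)
next
  case 6 show ?case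
    by (auto simp: add_map_def lhom_closed N.M.a_comm intro!: restrict_ext)
next
  case 7 show ?case
    by (auto simp: add_map_def lhom_closed N.M.a_assoc intro!: restrict_ext)
next
  case 8 show ?case
  proof
    fix f assume "f \<in> carrier (hom_space A M N)"
    then have f: "f \<in> lhom A M N" by simp
    have "add_map M N f (zero_map M N) = f"
      by (rule lhom_ext[OF add_map_lhom[OF f zero_map_lhom] f])
        (simp add: add_map_def zero_map_def lhom_closed[OF f])
    then show "f \<oplus>\<^bsub>hom_space A M N\<^esub> \<zero>\<^bsub>hom_space A M N\<^esub> = f" by simp
  qed
next
  case 9 show ?case
    by (auto simp: scale_map_def lhom_closed scalar_one_mult N.smult_assoc intro!: restrict_ext)
next
  case 10 show ?case
  proof
    fix f assume "f \<in> carrier (hom_space A M N)"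
    then have f: "f \<in> lhom A M N" by simp
    have "scale_map A M N \<one>\<^bsub>K\<^esub> f = f"
      by (rule lhom_ext[OF scale_map_lhom[OF _ f] f])
        (simp_all add: scale_map_def N.smult_one lhom_closed[OF f])
    then show "\<one>\<^bsub>K\<^esub> \<odot>\<^bsub>hom_space A M N\<^esub> f = f" by simp
  qed
next
  case 11 show ?case
    by (auto simp: scale_map_def add_map_def lhom_closed V.smult_l_distr N.smult_l_distr
        intro!: restrict_ext)
next
  case 12 show ?case
    by (auto simp: scale_map_def add_map_def lhom_closed N.smult_r_distr intro!: restrict_ext)
qed

lemma evaluation_linear:
  assumes x: "x \<in> carrier M"
  shows "(\<lambda>f. f x) \<in> module_hom K (hom_space A M N) (scalar_space A N)"
  using x by (auto simp: module_hom_def add_map_def scale_map_def lhom_closed)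

lemma lhom_zero:
  assumes f: "f \<in> lhom A M N"
  shows "f \<zero>\<^bsub>M\<^esub> = \<zero>\<^bsub>N\<^esub>"
proof -
  have "f (\<zero>\<^bsub>A\<^esub> \<odot>\<^bsub>M\<^esub> \<zero>\<^bsub>M\<^esub>) = \<zero>\<^bsub>A\<^esub> \<odot>\<^bsub>N\<^esub> f \<zero>\<^bsub>M\<^esub>"
    using f by (simp add: lhom_iff)
  then show ?thesis
    using lhom_closed[OF f] by (simp add: M.smult_zero_left N.smult_zero_left)
qed

lemma lhom_kernel_submod:
  assumes f: "f \<in> lhom A M N"
  shows "submod A M {x \<in> carrier M. f x = \<zero>\<^bsub>N\<^esub>}"
  using f lhom_zero[OF f]
  by (auto simp: submod_iff[OF M] lhom_iff M.smult_closed N.smult_zero_right)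

end

text \<open>A homomorphism is determined by its values at finitely many generators of \<open>M\<close>, as its kernel
  is a submodule; so the evaluations at these generators are jointly injective.\<close>

lemma hom_space_fin_dim:
  assumes M: "M \<in> fg_mod A" and N: "N \<in> fg_mod A"
  shows "vectorspace.fin_dim K (hom_space A M N)"
proof -
  have lM: "left_module A M" and lN: "left_module A N" using M N by (simp_all add: fg_mod_def)
  obtain S where S: "finite S" "S \<subseteq> carrier M"
    and gen: "\<And>N. submod A M N \<Longrightarrow> S \<subseteq> N \<Longrightarrow> N = carrier M"
    using M by (auto simp: fg_mod_def)
  show ?thesis
  proof (rule fin_dim_if_jointly_injective[where T = "\<lambda>s f. f s"])
    show "vectorspace K (hom_space A M N)" by (rule hom_space_vectorspace[OF lM lN])
    show "vectorspace K (scalar_space A N)" by (rule scalar_space_vectorspace[OF lN])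
    show "vectorspace.fin_dim K (scalar_space A N)" by (rule scalar_space_fin_dim[OF N])
    show "finite S" by fact
    show "(\<lambda>f. f s) \<in> module_hom K (hom_space A M N) (scalar_space A N)" if "s \<in> S" for s
      using evaluation_linear[OF lM lN] S that by blast
  next
    fix f assume "f \<in> carrier (hom_space A M N)" and "\<And>s. s \<in> S \<Longrightarrow> f s = \<zero>\<^bsub>scalar_space A N\<^esub>"
    then have f: "f \<in> lhom A M N" and fS: "\<And>s. s \<in> S \<Longrightarrow> f s = \<zero>\<^bsub>N\<^esub>" by simp_all
    have "{x \<in> carrier M. f x = \<zero>\<^bsub>N\<^esub>} = carrier M"
      by (rule gen[OF lhom_kernel_submod[OF lM lN f]]) (use S fS in auto)
    then have "f = zero_map M N"
      by (intro lhom_ext[OF f zero_map_lhom[OF lM lN]]) (auto simp: zero_map_def)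
    then show "f = \<zero>\<^bsub>hom_space A M N\<^esub>" by simp
  qed
qed

text \<open>A submodule \<open>N'\<close> shares its operations with \<open>N\<close>, so that the two spaces of homomorphisms
  differ in the carrier only; a record equation of this shape is what makes the lemmas on subspaces
  applicable.\<close>

lemma hom_space_sub:
  "hom_space A M (sub N N') = (hom_space A M N)\<lparr>carrier := lhom A M (sub N N')\<rparr>"
  by (simp add: hom_space_def zero_map_def[abs_def] add_map_def[abs_def] scale_map_def[abs_def])

lemma lhom_sub_subspace:
  assumes M: "left_module A M" and N: "left_module A N" and N': "submod A N N'"
  shows "submodule K (lhom A M (sub N N')) (hom_space A M N)"
proof -
  have sub: "lhom A M (sub N N') = {f \<in> lhom A M N. \<forall>x \<in> carrier M. f x \<in> N'}"
    using N' by (auto simp: lhom_iff submod_iff[OF N] Pi_iff)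
  have "module K (hom_space A M N)"
    using hom_space_vectorspace[OF M N] by (simp add: vectorspace_def)
  then show ?thesis
    unfolding submodule_def sub
    using N' zero_map_lhom[OF M N] add_map_lhom[OF M N] scale_map_lhom[OF M N]
    by (auto simp: submod_iff[OF N] zero_map_def add_map_def scale_map_def)
qed

lemma hom_dim_sub_le:
  assumes M: "M \<in> fg_mod A" and N: "N \<in> fg_mod A" and N': "submod A N N'"
  shows "vectorspace.dim K (hom_space A M (sub N N')) \<le> vectorspace.dim K (hom_space A M N)"
proof -
  have lM: "left_module A M" and lN: "left_module A N" using M N by (simp_all add: fg_mod_def)
  show ?thesis
    unfolding hom_space_sub
    by (rule vectorspace.subspace_dim_le[OF hom_space_vectorspace[OF lM lN]
          hom_space_fin_dim[OF M N] lhom_sub_subspace[OF lM lN N']])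
qed

lemma hom_dim_zero_submodule:
  assumes M: "left_module A M" and N: "left_module A N"
  shows "vectorspace.dim K (hom_space A M (sub N {\<zero>\<^bsub>N\<^esub>})) = 0"
proof -
  interpret M: left_module A M by fact
  interpret N: left_module A N by fact
  interpret H: vectorspace K "hom_space A M N" by (rule hom_space_vectorspace[OF M N])
  let ?W = "lhom A M (sub N {\<zero>\<^bsub>N\<^esub>})"
  have "submod A N {\<zero>\<^bsub>N\<^esub>}" by (auto simp: submod_iff[OF N] N.smult_zero_right)
  then have sub: "submodule K ?W (hom_space A M N)" by (rule lhom_sub_subspace[OF M N])
  then have "subspace K ?W (hom_space A M N)"
    using H.vectorspace_axioms by (simp add: subspace_def)
  then interpret W: vectorspace K "hom_space A M (sub N {\<zero>\<^bsub>N\<^esub>})"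
    unfolding hom_space_sub by (rule H.subspace_is_vs)
  have "f = zero_map M N" if f: "f \<in> ?W" for f
    using f zero_map_lhom[OF M N]
    by (intro extensionalityI[of f "carrier M"]) (auto simp: lhom_iff zero_map_def)
  moreover have "\<zero>\<^bsub>hom_space A M (sub N {\<zero>\<^bsub>N\<^esub>})\<^esub> \<in> W.span {}"
    using W.span_is_submodule[of "{}"] unfolding submodule_def by blast
  ultimately have "?W \<subseteq> W.span {}"
    by (auto simp: zero_map_def)
  then have "W.span {} = carrier (hom_space A M (sub N {\<zero>\<^bsub>N\<^esub>}))"
    using W.span_is_subset2[of "{}"] by auto
  then show ?thesis using W.gen_ge_dim[of "{}"] by simp
qed

end


section \<open>Dimension vectors of submodules\<close>

text \<open>A module may well have infinitely many submodules, but each entry of their dimension vectors is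
  a natural number bounded by the corresponding entry for \<open>X\<close>.\<close>

lemma (in fd_alg) finite_submodule_dimvecs:
  fixes P :: "'n::finite \<Rightarrow> ('k, 'a) lmod"
  assumes P: "\<And>i. P i \<in> fg_mod A" and X: "X \<in> fg_mod A"
  shows "finite {dimvec K A P (sub X X') | X'. submod A X X'}"
proof (rule finite_subset)
  let ?d = "\<lambda>i Y. vectorspace.dim K (hom_space A (P i) Y)"
  let ?F = "(\<lambda>m. \<chi> i. real (m i)) ` (\<Pi>\<^sub>E i \<in> UNIV. {..?d i X})"
  show "finite ?F" by (intro finite_imageI finite_PiE) auto
  show "{dimvec K A P (sub X X') | X'. submod A X X'} \<subseteq> ?F"
    using hom_dim_sub_le[OF P X] by (fastforce simp: dimvec_def)
qed

lemma (in fd_alg) dimvec_zero_submodule: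
  assumes "\<And>i. P i \<in> fg_mod A" and "X \<in> fg_mod A"
  shows "dimvec K A P (sub X {\<zero>\<^bsub>X\<^esub>}) = 0"
  using assms by (simp add: dimvec_def vec_eq_iff hom_dim_zero_submodule fg_mod_def)

lemma submod_trans:
  assumes M: "left_module A M" and N: "submod A M N" and L: "submod A (sub M N) L"
  shows "submod A M L"
proof -
  interpret M: left_module A M by fact
  have NM: "subgroup N (add_monoid M)"
    using N by (simp add: submod_def Module.submodule_def)
  have "subgroup L ((add_monoid M)\<lparr>carrier := N\<rparr>)"
    using L by (simp add: submod_def Module.submodule_def)
  then have "subgroup L (add_monoid M)"
    using M.M.add.incl_subgroup[OF NM] by simp
  then show ?thesis
    using L by (simp add: submod_def Module.submodule_def submodule_axioms_def)
qed


section \<open>Cones of semistability at a point and in its orthogonal complement\<close>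

text \<open>For each single \<open>d\<close> the inequality holds for all small enough \<open>\<epsilon> > 0\<close>: by continuity if
  \<open>v \<bullet> d < 0\<close>, and by the hypothesis on \<open>w\<close> if \<open>v \<bullet> d = 0\<close>. Finitely many such conditions can be met
  at once.\<close>

lemma finite_first_order_nonpos:
  fixes v w :: "'v::real_inner"
  assumes F: "finite F" and v: "\<And>d. d \<in> F \<Longrightarrow> v \<bullet> d \<le> 0"
    and w: "\<And>d. d \<in> F \<Longrightarrow> v \<bullet> d = 0 \<Longrightarrow> w \<bullet> d \<le> 0"
  shows "\<exists>\<epsilon> > 0. \<forall>d \<in> F. (v + \<epsilon> *\<^sub>R w) \<bullet> d \<le> 0"
proof -
  have "\<forall>\<^sub>F \<epsilon> in at_right 0. (v + \<epsilon> *\<^sub>R w) \<bullet> d \<le> 0" if d: "d \<in> F" for d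
  proof (cases "v \<bullet> d = 0")
    case True
    have "\<forall>\<^sub>F \<epsilon> in at_right (0::real). \<epsilon> > 0" by (rule eventually_at_right_less)
    then show ?thesis
      by eventually_elim (use w[OF d True] True in \<open>simp add: inner_add_left mult_nonneg_nonpos\<close>)
  next
    case False
    have "((\<lambda>\<epsilon>. (v + \<epsilon> *\<^sub>R w) \<bullet> d) \<longlongrightarrow> (v + 0 *\<^sub>R w) \<bullet> d) (at_right 0)"
      by (intro tendsto_intros)
    moreover have "(v + 0 *\<^sub>R w) \<bullet> d < 0" using False v[OF d] by simp
    ultimately have "\<forall>\<^sub>F \<epsilon> in at_right 0. (v + \<epsilon> *\<^sub>R w) \<bullet> d < 0" by (rule order_tendstoD)
    then show ?thesis by eventually_elim simp
  qed
  then have "\<forall>\<^sub>F \<epsilon> in at_right 0. \<forall>d \<in> F. (v + \<epsilon> *\<^sub>R w) \<bullet> d \<le> 0"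
    using F by (simp add: eventually_ball_finite)
  then have "\<forall>\<^sub>F \<epsilon> in at_right 0. \<epsilon> > 0 \<and> (\<forall>d \<in> F. (v + \<epsilon> *\<^sub>R w) \<bullet> d \<le> 0)"
    using eventually_at_right_less[of "0::real"] by eventually_elim simp
  then show ?thesis
    using eventually_happens by fastforce
qed

text \<open>As \<open>v \<in> D(X)\<close>, all submodules satisfy \<open>v \<bullet> dim X' \<le> 0\<close>. So those that do not constrain
  \<open>D_perp\<close> satisfy a strict inequality, which survives small perturbations of \<open>v\<close>.\<close>

lemma (in fd_alg) D_perp_eq_D_inf:
  fixes P :: "'n::finite \<Rightarrow> ('k, 'a) lmod"
  assumes P: "\<And>i. P i \<in> fg_mod A" and X: "X \<in> fg_mod A"
    and v: "v \<in> semistability_domain K A P X"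
  shows "D_perp K A P v X = D_inf K A P v X"
proof (intro equalityI subsetI)
  fix w assume w: "w \<in> D_perp K A P v X"
  let ?F = "{dimvec K A P (sub X X') | X'. submod A X X'}"
  have "\<exists>\<epsilon> > 0. \<forall>d \<in> ?F. (v + \<epsilon> *\<^sub>R w) \<bullet> d \<le> 0"
    using v w by (intro finite_first_order_nonpos finite_submodule_dimvecs P X)
      (auto simp: semistability_domain_def D_perp_def)
  then show "w \<in> D_inf K A P v X"
    using v w by (auto simp: D_inf_def D_perp_def semistability_domain_def inner_add_left)
next
  fix w assume "w \<in> D_inf K A P v X"
  then obtain \<epsilon> where w: "w \<in> perp v" and \<epsilon>: "\<epsilon> > 0"
    and dom: "v + \<epsilon> *\<^sub>R w \<in> semistability_domain K A P X"
    by (auto simp: D_inf_def)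
  have "w \<bullet> dimvec K A P X = 0"
    using dom v \<epsilon> by (simp add: semistability_domain_def inner_add_left)
  moreover have "w \<bullet> dimvec K A P (sub X X') \<le> 0"
    if "submod A X X'" "v \<bullet> dimvec K A P (sub X X') = 0" for X'
    using dom that \<epsilon> by (auto simp: semistability_domain_def inner_add_left mult_le_0_iff)
  ultimately show "w \<in> D_perp K A P v X" using w by (simp add: D_perp_def)
qed

lemma (in fd_alg) walls_eq:
  fixes P :: "'n::finite \<Rightarrow> ('k, 'a) lmod"
  assumes "\<And>i. P i \<in> fg_mod A"
  shows "perp_walls K A P v = infinitesimal_walls K A P v"
  unfolding perp_walls_def infinitesimal_walls_def
  by (intro Collect_cong ex_cong1) (auto simp: D_perp_eq_D_inf[of P, OF assms])

text \<open>Regular submodules are by definition nonzero and have to satisfy inequalities for all their own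
  submodules. The latter are inherited from \<open>X\<close>, and the zero submodule, the only one that
  \<open>D_perp\<close> takes into account in addition, contributes the inequality \<open>0 \<le> 0\<close>.\<close>

lemma (in fd_alg) regular_domain_eq_D_perp:
  fixes P :: "'n::finite \<Rightarrow> ('k, 'a) lmod"
  assumes P: "\<And>i. P i \<in> fg_mod A" and X: "X \<in> fg_mod A"
    and g: "g \<in> semistability_domain K A P X"
  shows "regular_domain K A P g X = D_perp K A P g X"
proof -
  have lX: "left_module A X" using X by (simp add: fg_mod_def)
  have iff: "regular K A P g (sub X X') \<longleftrightarrow> X' \<noteq> {\<zero>\<^bsub>X\<^esub>} \<and> g \<bullet> dimvec K A P (sub X X') = 0"
    if X': "submod A X X'" for X'
  proof -
    have "g \<bullet> dimvec K A P (sub X Y) \<le> 0" if "submod A (sub X X') Y" for Y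
      using submod_trans[OF lX X' that] g by (simp add: semistability_domain_def)
    then show ?thesis by (auto simp: regular_def nonzero_def semistability_domain_def)
  qed
  have "w \<bullet> dimvec K A P (sub X X') \<le> 0" if "X' = {\<zero>\<^bsub>X\<^esub>}" for w X'
    using dimvec_zero_submodule[of P, OF P X] that by simp
  then show ?thesis
    unfolding regular_domain_def D_perp_def using iff by blast
qed

lemma (in fd_alg) regular_picture_eq:
  fixes P :: "'n::finite \<Rightarrow> ('k, 'a) lmod"
  assumes P: "\<And>i. P i \<in> fg_mod A"
  shows "regular_picture K A P g = infinitesimal_picture K A P g"
proof -
  have "{regular_domain K A P g X | X. X \<in> fg_mod A \<and> regular K A P g X} = perp_walls K A P g"
    unfolding perp_walls_def regular_def
    by (intro Collect_cong ex_cong1) (auto simp: regular_domain_eq_D_perp[of P, OF P])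
  then show ?thesis
    by (simp add: regular_picture_def infinitesimal_picture_def walls_eq[of P, OF P])
qed

theorem theoremA:
  fixes K :: "'k ring"
    and \<Lambda> :: "('k, 'a) module"
    and P :: "'n::finite \<Rightarrow> ('a, nat \<Rightarrow> 'k) module"
    and v :: "real ^ 'n"
  assumes "algebraically_closed K"
    and "fd_algebra K \<Lambda>" and "basic_algebra \<Lambda>" and "connected_algebra \<Lambda>"
    and "CARD('n) = num_simples \<Lambda>" and "indec_projectives \<Lambda> P"
    and "v \<noteq> 0"
  shows "perp_structure K \<Lambda> P v = infinitesimal_structure K \<Lambda> P v \<and>
    (tame_hereditary K \<Lambda> \<or> tame_cluster_tilted K \<Lambda> \<longrightarrow>
       (\<forall>\<eta> g. null_root K \<Lambda> P \<eta> g \<longrightarrow>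
          regular_picture K \<Lambda> P g = infinitesimal_picture K \<Lambda> P g))"
proof -
  interpret fd_alg K \<Lambda> by (rule fd_alg.intro) fact
  have P: "\<And>i. P i \<in> fg_mod \<Lambda>"
    using assms(6) by (simp add: indec_projectives_def)
  show ?thesis
    using walls_eq[of P, OF P] regular_picture_eq[of P, OF P]
    by (simp add: perp_structure_def infinitesimal_structure_def)
qed

end
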